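(* Let $p\neq q$ be primes with $\gcd(pq,6)=1$ and let $G$ be a finite cyclic group of order $pq$. Then every minimal zero-sum sequence $S$ over $G$ of length $|S|=4$ has $\operatorname{ind}(S)=1$.
   Context: $G$ is an additively written finite cyclic group of order $n$. A sequence over $G$ is a finite unordered sequence (multiset) of elements of $G$, repetition allowed, written multiplicatively. A sequence is zero-sum if its terms sum to $0$; it is a minimal zero-sum sequence if it is zero-sum and no proper nontrivial subsequence has sum zero. For a generator $h$ of $G$ and a sequence $S=(m_1h)\cdot\ldots\cdot(m_lh)$ with integers $1\le m_1,\dots,m_l\le n$, put $\|S\|_h=\frac{m_1+\cdots+m_l}{n}$. The index of $S$ is $\operatorname{ind}(S)=\min\{\|S\|_h : h\in G,\ \langle h\rangle=G\}$. *)

theory Defs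
  imports
    "HOL-Algebra.Algebra"
    "HOL-Library.Multiset"
    "HOL-Computational_Algebra.Primes"
begin

(* The group is the multiplicative structure of HOL-Algebra, so the additive expressions
   m h, a + b and 0 are rendered as h [^] m, the group product and the group unit. A sequence
   over G is a multiset S with set_mset S a subset of carrier G, and its length is size S. *)

(* The value of all terms of S combined, each distinct term g counted with multiplicity count S g.
   It is meaningful only for commutative G and set_mset S a subset of carrier G. *)
definition seq_sum :: "('a, 'b) monoid_scheme \<Rightarrow> 'a multiset \<Rightarrow> 'a" where
  "seq_sum G S = (\<Otimes>\<^bsub>G\<^esub>g\<in>set_mset S. g [^]\<^bsub>G\<^esub> count S g)"

definition zero_sum :: "('a, 'b) monoid_scheme \<Rightarrow> 'a multiset \<Rightarrow> bool" where
  "zero_sum G S \<longleftrightarrow> seq_sum G S = \<one>\<^bsub>G\<^esub>"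

definition minimal_zero_sum :: "('a, 'b) monoid_scheme \<Rightarrow> 'a multiset \<Rightarrow> bool" where
  "minimal_zero_sum G S \<longleftrightarrow>
     zero_sum G S \<and> (\<forall>T. T \<subset># S \<and> T \<noteq> {#} \<longrightarrow> \<not> zero_sum G T)"

definition generators :: "('a, 'b) monoid_scheme \<Rightarrow> 'a set" where
  "generators G = {h \<in> carrier G. generate G {h} = carrier G}"

(* The range 1..n (not 0..n-1) makes the neutral element have coefficient n = order G. *)
definition gen_coeff :: "('a, 'b) monoid_scheme \<Rightarrow> 'a \<Rightarrow> 'a \<Rightarrow> nat" where
  "gen_coeff G h x = (THE m. 1 \<le> m \<and> m \<le> order G \<and> x = h [^]\<^bsub>G\<^esub> m)"

definition seq_norm :: "('a, 'b) monoid_scheme \<Rightarrow> 'a \<Rightarrow> 'a multiset \<Rightarrow> real" where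
  "seq_norm G h S = real (\<Sum>x\<in>#S. gen_coeff G h x) / real (order G)"

definition seq_index :: "('a, 'b) monoid_scheme \<Rightarrow> 'a multiset \<Rightarrow> real" where
  "seq_index G S = Min {seq_norm G h S | h. h \<in> generators G}"

lemma gen_coeff_unique:
  fixes G (structure)
  assumes "group G" and fin: "finite (carrier G)"
    and h: "h \<in> generators G" and x: "x \<in> carrier G"
  shows "\<exists>!m::nat. 1 \<le> m \<and> m \<le> order G \<and> x = h [^] m"
proof -
  interpret group G by fact
  have hc: "h \<in> carrier G" and hg: "generate G {h} = carrier G"
    using h by (auto simp: generators_def)
  have o: "ord h = order G"
    using generate_pow_card[OF hc] hg by (simp add: order_def)
  have bij: "inj_on (\<lambda>m::nat. h [^] m) {1..order G}"
    using ord_inj'[OF hc] o by simp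
  have "(\<lambda>m::nat. h [^] m) ` {1..order G} = carrier G"
    by (rule card_subset_eq[OF fin]) (use hc card_image[OF bij] in \<open>auto simp: order_def\<close>)
  then have "x \<in> (\<lambda>m::nat. h [^] m) ` {1..order G}" using x by (simp only:)
  then obtain m where m: "m \<in> {1..order G}" "x = h [^] m" by (elim imageE)
  show ?thesis
  proof (rule ex1I[of _ m])
    show "1 \<le> m \<and> m \<le> order G \<and> x = h [^] m" using m by simp
    show "k = m" if "1 \<le> k \<and> k \<le> order G \<and> x = h [^] k" for k
      by (rule inj_onD[OF bij]) (use that m in simp_all)
  qed
qed

lemma seq_sum_empty: "comm_group G \<Longrightarrow> seq_sum G {#} = \<one>\<^bsub>G\<^esub>"
  by (simp add: seq_sum_def comm_group_def comm_monoid.finprod_empty)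

lemma seq_sum_add_mset:
  fixes G (structure)
  assumes "comm_group G" "x \<in> carrier G" "set_mset S \<subseteq> carrier G"
  shows "seq_sum G (add_mset x S) = x \<otimes> seq_sum G S"
proof -
  interpret comm_group G by fact
  let ?A = "set_mset S - {x}"
  have c: "(\<lambda>g. g [^] count M g) \<in> ?A \<rightarrow> carrier G" for M using assms by auto
  have S: "seq_sum G S = x [^] count S x \<otimes> (\<Otimes>g\<in>?A. g [^] count S g)"
  proof (cases "x \<in># S")
    case True
    then have "set_mset S = insert x ?A" by auto
    then show ?thesis unfolding seq_sum_def
      using finprod_insert[of ?A x "\<lambda>g. g [^] count S g"] c assms by simp
  next
    case False
    then have "count S x = 0" "?A = set_mset S" by (auto simp: not_in_iff)
    moreover have "(\<Otimes>g\<in>set_mset S. g [^] count S g) \<in> carrier G"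
      by (rule finprod_closed) (use assms in auto)
    ultimately show ?thesis by (simp add: seq_sum_def)
  qed
  have eq: "(\<Otimes>g\<in>?A. g [^] count (add_mset x S) g) = (\<Otimes>g\<in>?A. g [^] count S g)"
    by (rule finprod_cong') (use c in auto)
  have ins: "set_mset (add_mset x S) = insert x ?A" by auto
  have fA: "(\<Otimes>g\<in>?A. g [^] count S g) \<in> carrier G"
    by (rule finprod_closed[OF c])
  have "seq_sum G (add_mset x S)
      = x [^] count (add_mset x S) x \<otimes> (\<Otimes>g\<in>?A. g [^] count (add_mset x S) g)"
    unfolding seq_sum_def ins
    by (rule finprod_insert[OF _ _ c]) (use assms(2) in simp_all)
  also have "\<dots> = (x \<otimes> x [^] count S x) \<otimes> (\<Otimes>g\<in>?A. g [^] count S g)"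
    unfolding eq using nat_pow_Suc2[OF assms(2)] by simp
  also have "\<dots> = x \<otimes> seq_sum G S"
    unfolding S by (rule m_assoc[OF assms(2) nat_pow_closed[OF assms(2)] fA])
  finally show ?thesis .
qed

lemma seq_index_attained:
  fixes G (structure)
  assumes "finite (carrier G)" "cyclic_group G"
  shows "finite {seq_norm G h S | h. h \<in> generators G}"
    and "{seq_norm G h S | h. h \<in> generators G} \<noteq> {}"
proof -
  have "finite (generators G)" using assms(1) by (simp add: generators_def)
  then show "finite {seq_norm G h S | h. h \<in> generators G}" by simp
  obtain h where h: "h \<in> carrier G" and e: "subgroup_generated G {h} = G"
    using assms(2) by (auto simp: cyclic_group_def)
  have "generate G {h} = carrier (subgroup_generated G {h})"
    using h by (simp add: carrier_subgroup_generated)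
  also have "\<dots> = carrier G" by (rule arg_cong[OF e])
  finally have "h \<in> generators G" using h by (simp only: generators_def mem_Collect_eq)
  then show "{seq_norm G h S | h. h \<in> generators G} \<noteq> {}" by blast
qed

end

(* Suppose no generator gives norm 1. Replacing a generator h by -h exchanges the norms 1 and 3, so
   every generator gives norm 2: for the coefficients m_1, ..., m_4 of S this says that
   sum_i ({u m_i / n} - 1/2) = 0 for every unit u modulo n = pq. Multiply by an odd primitive
   Dirichlet character chi modulo n and sum over u: every m_i that is not a unit drops out, and what
   remains is conj(sum_i chi(m_i)) times sum_a chi(a) (a/n - 1/2). The second factor is a nonzero
   multiple of L(1, conj chi), hence nonzero, so sum_i chi(m_i) = 0. Summing these relations over
   all chi that are products of nonprincipal characters modulo p and modulo q gives a counting
   identity for the congruence classes of the unit m_i modulo p and modulo q, which fails if there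
   are units among the m_i and no m_i + m_j is zero. The remaining m_i are multiples of p or of q,
   and the characters modulo q and modulo p pair them off as x, -x, contradicting minimality. *)

theory Submission
  imports Defs "HOL-Analysis.Analysis" "HOL-Number_Theory.Number_Theory" "HOL-Real_Asymp.Real_Asymp"
begin

hide_const (open) Divisibility.prime Polynomial.order

section \<open>Dirichlet characters\<close>

text \<open>A nonunit m_i drops out because of primitivity: some unit u fixes m_i modulo n and has
  chi(u) different from 1, and substituting it multiplies the twisted sum at m_i by chi(u). Modulo
  pq this asks for a nonprincipal factor at each prime. Odd characters alone have no convenient
  orthogonality, so the relation is used as sum_i (chi(m_i) - chi(-m_i)) = 0, which is trivial for
  even chi; the price is that each class is counted against its negative. The nonvanishing of L(1,
  chi) splits in two: if chi^2 is nonprincipal, a zero is excluded by comparing zeta^3 L^4 with 1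
  near s = 1; for real chi this breaks down because the L-function of chi^2 has a pole itself, and
  nonnegative divisor sums take over. The condition gcd(pq, 6) = 1 enters twice: n odd means that no
  nonzero class is its own negative, and primes of at least 5 make the counting identity so rigid
  that it allows a single pattern of class sizes, which four terms cannot realise around every
  unit.\<close>

lemma summation_by_parts:
  fixes c :: "nat \<Rightarrow> complex" and a :: "nat \<Rightarrow> real"
  shows "(\<Sum>j<m. c j * of_real (a j)) = (\<Sum>j<m. c j) * of_real (a m)
           + (\<Sum>j<m. (\<Sum>i<Suc j. c i) * of_real (a j - a (Suc j)))"
  by (induction m) (simp_all add: algebra_simps)

text \<open>After summation by parts the nonnegative differences of \<open>a\<close> telescope, and
  the total is at most \<open>B * (a 0 - a m) + B * a m\<close>.\<close>

lemma norm_sum_mult_decseq_le: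
  fixes c :: "nat \<Rightarrow> complex" and a :: "nat \<Rightarrow> real"
  assumes B: "\<And>m. norm (\<Sum>j<m. c j) \<le> B" and dec: "decseq a" and nonneg: "\<And>j. 0 \<le> a j"
  shows "norm (\<Sum>j<m. c j * of_real (a j)) \<le> B * a 0"
proof -
  have "norm (\<Sum>j<m. (\<Sum>i<Suc j. c i) * of_real (a j - a (Suc j)))
      \<le> (\<Sum>j<m. B * (a j - a (Suc j)))"
  proof (rule sum_norm_le)
    fix j
    show "norm ((\<Sum>i<Suc j. c i) * of_real (a j - a (Suc j))) \<le> B * (a j - a (Suc j))"
      unfolding norm_mult norm_of_real using B[of "Suc j"] decseq_SucD[OF dec, of j]
      by (simp add: mult_right_mono del: sum.lessThan_Suc)
  qed
  also have "\<dots> = B * (a 0 - a m)"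
    by (simp add: sum_distrib_left[symmetric] sum_lessThan_telescope')
  finally have 1: "norm (\<Sum>j<m. (\<Sum>i<Suc j. c i) * of_real (a j - a (Suc j))) \<le> B * (a 0 - a m)" .
  have 2: "norm ((\<Sum>j<m. c j) * of_real (a m)) \<le> B * a m"
    using B[of m] nonneg[of m] by (simp add: norm_mult mult_right_mono)
  show ?thesis
    unfolding summation_by_parts[of c a m]
    by (rule order_trans[OF norm_triangle_ineq]) (use 1 2 in \<open>simp add: algebra_simps\<close>)
qed

text \<open>The partial sums of the shifted sequence are differences of two partial sums of
  \<open>c\<close>; hence the factor 2.\<close>

lemma norm_sum_mult_decseq_le':
  fixes c :: "nat \<Rightarrow> complex" and a :: "nat \<Rightarrow> real"
  assumes B: "\<And>m. norm (\<Sum>j<m. c j) \<le> B" and dec: "decseq a" and nonneg: "\<And>j. 0 \<le> a j"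
  shows "norm (\<Sum>j=k..<m. c j * of_real (a j)) \<le> 2 * B * a k"
proof (cases "k \<le> m")
  case True
  define c' where "c' = (\<lambda>j. c (j + k))"
  have sh: "(\<Sum>j<l. f (j + k)) = (\<Sum>j=k..<l+k. f j)" for f :: "nat \<Rightarrow> complex" and l
    using sum.shift_bounds_nat_ivl[of f 0 k l] by (simp add: lessThan_atLeast0)
  have diff: "(\<Sum>j<l. c' j) = (\<Sum>j<l+k. c j) - (\<Sum>j<k. c j)" for l
    unfolding c'_def sh using sum_diff_nat_ivl[of 0 k "l+k" c] by (simp add: lessThan_atLeast0)
  have bd: "norm (\<Sum>j<l. c' j) \<le> 2 * B" for l
    unfolding diff by (rule order_trans[OF norm_triangle_ineq4]) (use B[of k] B[of "l+k"] in simp)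
  have d': "decseq (\<lambda>j. a (j + k))"
    using dec by (auto simp: decseq_def)
  have "norm (\<Sum>j<m-k. c' j * of_real (a (j + k))) \<le> 2 * B * a (0 + k)"
    by (rule norm_sum_mult_decseq_le[OF bd d']) (rule nonneg)
  then show ?thesis
    unfolding c'_def sh[where f = "\<lambda>j. c j * of_real (a j)"] using True by simp
next
  case False
  have "0 \<le> B" using B[of 0] by simp
  then show ?thesis using False nonneg[of k] by simp
qed

text \<open>Dirichlet's test with explicit constants. They depend only on \<open>B\<close> and one
  value of \<open>a\<close>, so the bounds stay uniform when the weights vary with an exponent or a
  radius.\<close>

lemma summable_mult_decseq:
  fixes c :: "nat \<Rightarrow> complex" and a :: "nat \<Rightarrow> real"
  assumes B: "\<And>m. norm (\<Sum>j<m. c j) \<le> B" and dec: "decseq a" and lim: "a \<longlonglongrightarrow> 0"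
  shows "summable (\<lambda>j. c j * of_real (a j))"
    and "norm (suminf (\<lambda>j. c j * of_real (a j))) \<le> B * a 0"
    and "norm (suminf (\<lambda>j. c j * of_real (a j)) - (\<Sum>j<k. c j * of_real (a j))) \<le> 2 * B * a k"
proof -
  have nonneg: "0 \<le> a j" for j
    using decseq_ge[OF dec lim] .
  have lim2: "(\<lambda>k. 2 * B * a k) \<longlonglongrightarrow> 0"
    by (rule tendsto_eq_intros lim | simp)+
  show summ: "summable (\<lambda>j. c j * of_real (a j))"
    unfolding summable_Cauchy
  proof (intro allI impI)
    fix e :: real assume "0 < e"
    then obtain N where N: "\<And>k. k \<ge> N \<Longrightarrow> norm (2 * B * a k) < e"
      using LIMSEQ_D[OF lim2, of e] by auto
    show "\<exists>N. \<forall>m\<ge>N. \<forall>n. norm (\<Sum>j=m..<n. c j * of_real (a j)) < e"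
    proof (intro exI[of _ N] allI impI)
      fix m n assume "N \<le> m"
      then show "norm (\<Sum>j=m..<n. c j * of_real (a j)) < e"
        using norm_sum_mult_decseq_le'[OF B dec nonneg, where k=m and m=n] N[of m] by (simp add: abs_less_iff)
    qed
  qed
  have t: "(\<lambda>m. \<Sum>j<m. c j * of_real (a j)) \<longlonglongrightarrow> suminf (\<lambda>j. c j * of_real (a j))"
    using summable_LIMSEQ[OF summ] .
  show "norm (suminf (\<lambda>j. c j * of_real (a j))) \<le> B * a 0"
    by (rule LIMSEQ_le_const2[OF tendsto_norm[OF t]])
       (use norm_sum_mult_decseq_le[OF B dec nonneg] in auto)
  have t2: "(\<lambda>m. norm ((\<Sum>j<m. c j * of_real (a j)) - (\<Sum>j<k. c j * of_real (a j))))
      \<longlonglongrightarrow> norm (suminf (\<lambda>j. c j * of_real (a j)) - (\<Sum>j<k. c j * of_real (a j)))"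
    by (intro tendsto_norm tendsto_diff t tendsto_const)
  have "norm ((\<Sum>j<m. c j * of_real (a j)) - (\<Sum>j<k. c j * of_real (a j))) \<le> 2 * B * a k"
    if "k \<le> m" for m
  proof -
    have "(\<Sum>j<m. c j * of_real (a j)) - (\<Sum>j<k. c j * of_real (a j))
        = (\<Sum>j=k..<m. c j * of_real (a j))"
      using sum_diff_nat_ivl[of 0 k m "\<lambda>j. c j * of_real (a j)"] that by (simp add: lessThan_atLeast0)
    then show ?thesis using norm_sum_mult_decseq_le'[OF B dec nonneg] by simp
  qed
  then show "norm (suminf (\<lambda>j. c j * of_real (a j)) - (\<Sum>j<k. c j * of_real (a j))) \<le> 2 * B * a k"
    by (intro LIMSEQ_le_const2[OF t2] exI[of _ k]) auto
qed

section \<open>Permutations of residues, and Dirichlet characters on the integers\<close>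

lemma bij_betw_mult_mod:
  fixes u :: int and n :: nat
  assumes "coprime u (int n)" "0 < n"
  shows "bij_betw (\<lambda>a. (u * a) mod int n) {0..<int n} {0..<int n}"
proof -
  have inj: "inj_on (\<lambda>a. (u * a) mod int n) {0..<int n}"
  proof (rule inj_onI)
    fix a b assume a: "a \<in> {0..<int n}" and b: "b \<in> {0..<int n}"
      and e: "(u * a) mod int n = (u * b) mod int n"
    have "[u * a = u * b] (mod int n)" using e by (simp add: cong_def)
    then have "[a = b] (mod int n)"
      using cong_mult_lcancel[OF assms(1)] by blast
    then show "a = b" using a b by (simp add: cong_def)
  qed
  moreover have "(\<lambda>a. (u * a) mod int n) ` {0..<int n} = {0..<int n}"
    by (rule endo_inj_surj) (use inj assms in auto)
  ultimately show ?thesis by (simp add: bij_betw_def)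
qed

text \<open>This substitution is the source of the vanishing of character sums and of the separation
  formulas for Gauss and sawtooth sums.\<close>

lemma sum_mult_mod:
  fixes u :: int and n :: nat and F :: "int \<Rightarrow> 'a::comm_monoid_add"
  assumes "coprime u (int n)" "0 < n" and per: "\<And>a. F (a mod int n) = F a"
  shows "(\<Sum>a\<in>{0..<int n}. F (u * a)) = (\<Sum>a\<in>{0..<int n}. F a)"
  using sum.reindex_bij_betw[OF bij_betw_mult_mod[OF assms(1,2)], of F] by (simp add: per)

text \<open>The argument is an \<open>int\<close>, so that \<open>\<psi> (-1)\<close> and negated
  residues make sense directly. As \<open>\<psi>\<close> is nonzero exactly at the units,
  multiplicativity gives \<open>\<psi> 1 = 1\<close>, and \<open>1 < n\<close> gives
  \<open>\<psi> 0 = 0\<close>, on which index shifts below rely.\<close>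

locale dirichlet_character =
  fixes n :: nat and \<psi> :: "int \<Rightarrow> complex"
  assumes n_gt_1: "1 < n"
    and mult: "\<psi> (a * b) = \<psi> a * \<psi> b"
    and periodic: "\<psi> (a mod int n) = \<psi> a"
    and eq_0_iff: "\<psi> a = 0 \<longleftrightarrow> \<not> coprime a (int n)"
begin

lemma one [simp]: "\<psi> 1 = 1"
  using mult[of 1 1] eq_0_iff[of 1] by simp

lemma zero [simp]: "\<psi> 0 = 0"
  using eq_0_iff[of 0] n_gt_1 by simp

lemma power: "\<psi> (a ^ k) = \<psi> a ^ k"
  by (induction k) (simp_all add: mult)

lemma cong_eq: "[a = b] (mod int n) \<Longrightarrow> \<psi> a = \<psi> b"
  by (metis periodic cong_def)

text \<open>Euler's theorem makes the value at a unit a root of unity.\<close>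

lemma norm_eq_1:
  assumes "coprime a (int n)"
  shows "norm (\<psi> a) = 1"
proof -
  define b where "b = nat (a mod int n)"
  have b: "int b = a mod int n" using n_gt_1 by (simp add: b_def)
  have "coprime (int b) (int n)" unfolding b using assms n_gt_1 by simp
  then have "coprime b n" by simp
  then have "[b ^ totient n = 1] (mod n)" by (rule euler_theorem)
  then have "[int b ^ totient n = 1] (mod int n)"
    by (metis cong_int_iff of_nat_1 of_nat_power)
  then have "\<psi> (int b) ^ totient n = 1"
    using cong_eq power by (metis one)
  then have "norm (\<psi> (int b)) ^ totient n = 1"
    by (metis norm_one norm_power)
  then have "norm (\<psi> (int b)) = 1"
    using n_gt_1 power_eq_1_iff[of "norm (\<psi> (int b))" "totient n"] by simp
  then show ?thesis unfolding b periodic .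
qed

lemma norm_le_1: "norm (\<psi> a) \<le> 1"
  using norm_eq_1[of a] eq_0_iff[of a] by (cases "coprime a (int n)") auto

lemma cnj_character: "dirichlet_character n (\<lambda>a. cnj (\<psi> a))"
  by unfold_locales (use n_gt_1 in \<open>simp_all add: mult periodic eq_0_iff\<close>)

lemma square_character: "dirichlet_character n (\<lambda>a. (\<psi> a)\<^sup>2)"
  by unfold_locales (use n_gt_1 in \<open>simp_all add: mult periodic eq_0_iff power_mult_distrib\<close>)

lemma sum_eq_0:
  assumes "coprime u (int n)" "\<psi> u \<noteq> 1"
  shows "(\<Sum>a\<in>{0..<int n}. \<psi> a) = 0"
proof -
  have "(\<Sum>a\<in>{0..<int n}. \<psi> (u * a)) = (\<Sum>a\<in>{0..<int n}. \<psi> a)"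
    by (rule sum_mult_mod) (use assms n_gt_1 periodic in auto)
  then have "(\<psi> u - 1) * (\<Sum>a\<in>{0..<int n}. \<psi> a) = 0"
    by (simp add: mult sum_distrib_left[symmetric] left_diff_distrib)
  then show ?thesis using assms by simp
qed

text \<open>The sum over a full period vanishes, so periods can be removed until fewer than
  \<open>n\<close> terms of norm at most 1 remain.\<close>

lemma norm_sum_le:
  assumes "coprime u (int n)" "\<psi> u \<noteq> 1"
  shows "norm (\<Sum>j<m. \<psi> (int (Suc j))) \<le> n"
proof -
  define T where "T = (\<lambda>m. \<Sum>j<m. \<psi> (int j))"
  have "T n = (\<Sum>a\<in>{0..<int n}. \<psi> a)"
    unfolding T_def lessThan_atLeast0 
    by (rule sum.reindex_bij_witness[of _ nat int]) auto
  then have Xn: "T n = 0" using sum_eq_0[OF assms] by simp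
  have per: "T (m + n) = T m" for m
  proof (induction m)
    case (Suc m)
    have "\<psi> (int (m + n)) = \<psi> (int m)"
      by (rule cong_eq) (simp add: cong_def)
    then show ?case using Suc by (simp add: T_def)
  qed (use Xn in \<open>simp add: T_def\<close>)
  have "norm (T m) \<le> n" for m
  proof (induction m rule: less_induct)
    case (less m)
    show ?case
    proof (cases "m < n")
      case True
      have "norm (T m) \<le> (\<Sum>j<m. 1)"
        unfolding T_def by (rule sum_norm_le) (rule norm_le_1)
      then show ?thesis using True by simp
    next
      case False
      then show ?thesis using per[of "m - n"] less[of "m - n"] n_gt_1 by simp
    qed
  qed
  moreover have "(\<Sum>j<m. \<psi> (int (Suc j))) = T (Suc m)"
    unfolding T_def by (subst sum.lessThan_Suc_shift) simp
  ultimately show ?thesis by simp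
qed

end

section \<open>Nonvanishing of L(1) for complex characters\<close>

lemma sum_inverse_le_ln: "(\<Sum>j<N. 1 / real (Suc j)) \<le> 1 + ln (real N)" if "0 < N" for N :: nat
  using that
proof (induction N rule: nat_induct_non_zero)
  case (Suc N)
  have "ln (real N / real (Suc N)) \<le> real N / real (Suc N) - 1"
    using Suc by (intro ln_le_minus_one) simp
  then have "1 / real (Suc N) \<le> ln (real (Suc N)) - ln (real N)"
    using Suc by (simp add: ln_div field_simps)
  then show ?case using Suc.IH by simp
qed simp

text \<open>The bound reflects the simple pole of the zeta function; for \<open>d = 1 / N\<close> it
  reads \<open>1 + N\<close>.\<close>

lemma zeta_series_bound:
  assumes "0 < d"
  shows "summable (\<lambda>j. real (Suc j) powr -(1 + d))"
    and "suminf (\<lambda>j. real (Suc j) powr -(1 + d)) \<le> 1 + 1 / d"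
proof -
  \<comment> \<open>A discrete substitute for the integral of x^(-1-d): the logarithm of the ratio
    of consecutive integers is at least 1/(m+1), and exp x \<ge> 1 + x turns this into a telescoping
    difference.\<close>
  have step: "real (Suc m) powr -(1 + d) \<le> (real m powr -d - real (Suc m) powr -d) / d" if "0 < m" for m
  proof -
    have "ln (real m / real (Suc m)) \<le> real m / real (Suc m) - 1"
      using that by (intro ln_le_minus_one) simp
    then have l: "1 / real (Suc m) \<le> ln (real (Suc m)) - ln (real m)"
      using that by (simp add: ln_div field_simps)
    have "1 + d * (ln (real (Suc m)) - ln (real m)) \<le> exp (d * (ln (real (Suc m)) - ln (real m)))"
      by (rule exp_ge_add_one_self)
    also have "\<dots> = real m powr -d / real (Suc m) powr -d"
      using that by (simp add: powr_def exp_diff[symmetric] algebra_simps)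
    finally have "1 + d * (1 / real (Suc m)) \<le> real m powr -d / real (Suc m) powr -d"
      using mult_left_mono[OF l, of d] assms by linarith
    then have "(1 + d / real (Suc m)) * real (Suc m) powr -d \<le> real m powr -d"
      by (simp add: field_simps)
    moreover have "real (Suc m) powr -(1 + d) = real (Suc m) powr -d / real (Suc m)"
      unfolding minus_add_distrib powr_add powr_minus_divide[of _ 1] by simp
    ultimately have "real (Suc m) powr -(1 + d) * d \<le> real m powr -d - real (Suc m) powr -d"
      by (simp only: ring_distribs times_divide_eq_left times_divide_eq_right mult_1_left mult.commute[of _ d])
    then show ?thesis by (simp only: pos_le_divide_eq[OF assms])
  qed
  have bd: "(\<Sum>j<Suc m. real (Suc j) powr -(1 + d)) \<le> 1 + (1 - real (Suc m) powr -d) / d" for m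
  proof (induction m)
    case (Suc m)
    then show ?case using step[of "Suc m"] by (simp add: diff_divide_distrib)
  qed simp
  have bd': "(\<Sum>j<m. real (Suc j) powr -(1 + d)) \<le> 1 + 1 / d" for m
  proof -
    have "(\<Sum>j<m. real (Suc j) powr -(1 + d)) \<le> (\<Sum>j<Suc m. real (Suc j) powr -(1 + d))" by simp
    also have "\<dots> \<le> 1 + (1 - real (Suc m) powr -d) / d" by (rule bd)
    also have "\<dots> \<le> 1 + 1 / d" using assms by (simp add: divide_right_mono)
    finally show ?thesis .
  qed
  show "summable (\<lambda>j. real (Suc j) powr -(1 + d))"
    by (rule summableI_nonneg_bounded[OF _ bd']) simp
  then show "suminf (\<lambda>j. real (Suc j) powr -(1 + d)) \<le> 1 + 1 / d"
    by (rule suminf_le_const[OF _ bd'])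
qed

text \<open>The sieve of Eratosthenes: by complete multiplicativity the factor
  \<open>1 - f p\<close> removes the multiples of \<open>p\<close>. What is left is 1 plus part of
  the tail of an absolutely convergent series.\<close>

lemma euler_product_tendsto:
  fixes f :: "nat \<Rightarrow> complex"
  assumes f0: "f 0 = 0" and f1: "f 1 = 1" and mult: "\<And>a b. f (a * b) = f a * f b"
    and summ: "summable (\<lambda>m. norm (f m))"
  shows "(\<lambda>N. suminf f * (\<Prod>p | prime p \<and> p < N. 1 - f p)) \<longlonglongrightarrow> 1"
proof -
  define M where "M = (\<lambda>N. {m::nat. \<forall>p. prime p \<and> p < N \<longrightarrow> \<not> p dvd m})"
  define g where "g = (\<lambda>N m. if m \<in> M N then f m else 0)"
  have summ_g: "summable (\<lambda>m. norm (h m))" if "\<And>m. norm (h m) \<le> norm (f m)" for h :: "nat \<Rightarrow> complex"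
    by (rule summable_comparison_test'[OF summ, of 0]) (use that in simp)
  have sg: "summable (g N)" for N
    by (rule summable_norm_cancel[OF summ_g]) (simp add: g_def)
  have prod: "suminf f * (\<Prod>p | prime p \<and> p < N. 1 - f p) = suminf (g N)" for N
  proof (induction N)
    case 0
    have "g 0 = f" by (rule ext) (simp add: g_def M_def)
    then show ?case by simp
  next
    case (Suc N)
    show ?case
    proof (cases "prime N")
      case False
      have 1: "prime p \<and> p < Suc N \<longleftrightarrow> prime p \<and> p < N" for p
        using False by (auto simp: less_Suc_eq)
      have "M (Suc N) = M N" unfolding M_def 1 ..
      then show ?thesis using Suc by (simp add: g_def 1)
    next
      case True
      have N0: "0 < N" using True by (simp add: prime_gt_0_nat)
      have 1: "{p. prime p \<and> p < Suc N} = insert N {p. prime p \<and> p < N}"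
        using True by (auto simp: less_Suc_eq)
      \<comment> \<open>Only primes below \<open>N\<close> have been sieved out so far, so
        multiplication by the prime \<open>N\<close> does not affect membership.\<close>
      have mem: "N * k \<in> M N \<longleftrightarrow> k \<in> M N" for k
        unfolding M_def using True by (auto simp: prime_dvd_mult_iff dest: primes_dvd_imp_eq)
      define h where "h = (\<lambda>m. if N dvd m then g N m else 0)"
      have sh: "summable h"
        by (rule summable_norm_cancel[OF summ_g]) (simp add: h_def g_def)
      have "suminf (\<lambda>k. h (N * k)) = suminf h"
        by (rule suminf_mono_reindex) (use N0 in \<open>auto simp: strict_mono_def h_def\<close>)
      moreover have "h (N * k) = f N * g N k" for k
        by (simp add: h_def g_def mem mult)
      ultimately have h: "suminf h = f N * suminf (g N)"
        using suminf_mult[OF sg] by simp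
      have "M (Suc N) = {m \<in> M N. \<not> N dvd m}"
        unfolding M_def using True by (auto simp: less_Suc_eq)
      then have "g (Suc N) m = g N m - h m" for m
        by (auto simp: g_def h_def)
      then have "suminf (g (Suc N)) = suminf (g N) - suminf h"
        using suminf_diff[OF sg sh] by presburger
      moreover have "suminf f * (\<Prod>p | prime p \<and> p < Suc N. 1 - f p) = (1 - f N) * suminf (g N)"
        unfolding 1 by (subst prod.insert) (simp_all add: Suc[symmetric])
      ultimately show ?thesis unfolding h by (simp only: left_diff_distrib mult_1_left)
    qed
  qed
  have "(\<lambda>N. suminf (g N)) \<longlonglongrightarrow> 1"
  proof (rule LIMSEQ_I)
    fix e :: real assume "0 < e"
    then obtain K where K: "\<And>N. N \<ge> K \<Longrightarrow> norm (suminf (\<lambda>i. norm (f (i + N)))) < e"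
      using suminf_exist_split[OF _ summ, of e] by auto
    show "\<exists>K. \<forall>N\<ge>K. norm (suminf (g N) - 1) < e"
    proof (intro exI[of _ "max K 2"] allI impI)
      fix N assume N: "max K 2 \<le> N"
      define h where "h = (\<lambda>m. if m = 1 then 0 else g N m)"
      have nh: "norm (h m) \<le> norm (f m)" for m by (simp add: h_def g_def)
      have sh: "summable h" by (rule summable_norm_cancel[OF summ_g]) (rule nh)
      \<comment> \<open>A number strictly between 1 and \<open>N\<close> has a prime factor below
        \<open>N\<close>. The value \<open>f 0 = 0\<close> matters when \<open>N = 2\<close>, where
        nothing has been sieved out yet.\<close>
      have h0: "h m = 0" if "m < N" for m
      proof (cases "m \<le> 1")
        case True
        then show ?thesis using f0 by (cases m) (auto simp: h_def g_def)
      next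
        case False
        then obtain p where "prime p" "p dvd m" using prime_factor_nat[of m] by auto
        moreover have "p \<le> m" using \<open>p dvd m\<close> False by (intro dvd_imp_le) auto
        ultimately have "m \<notin> M N" using that unfolding M_def by force
        then show ?thesis by (simp add: h_def g_def)
      qed
      have "1 \<in> M N" by (auto simp: M_def)
      then have "g N m = (if m = 1 then 1 else 0) + h m" for m
        using f1 by (auto simp: h_def g_def)
      moreover have "(\<lambda>m. if m = (1::nat) then 1 else 0 :: complex) sums 1"
        using sums_single[of 1 "\<lambda>_. 1 :: complex"] by simp
      ultimately have "suminf (g N) = 1 + suminf h"
        using sums_unique[OF sums_add[OF _ summable_sums[OF sh]]] by presburger
      also have "suminf h = suminf (\<lambda>i. h (i + N))"
        using suminf_split_initial_segment[OF sh, of N] h0 by simp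
      finally have "norm (suminf (g N) - 1) = norm (suminf (\<lambda>i. h (i + N)))" by simp
      also have "\<dots> \<le> suminf (\<lambda>i. norm (f (i + N)))"
        by (rule norm_suminf_le[OF nh]) (rule summable_ignore_initial_segment[OF summ])
      also have "\<dots> \<le> norm (suminf (\<lambda>i. norm (f (i + N))))" by simp
      also have "\<dots> < e" using K N by simp
      finally show "norm (suminf (g N) - 1) < e" .
    qed
  qed
  then show ?thesis unfolding prod .
qed

text \<open>Mertens' inequality for a single Euler factor: 3 + 4 cos x + cos 2x = 2 (1 + cos x)^2
  \<ge> 0, applied to each coefficient of the logarithm. The case \<open>z = 0\<close> serves the
  primes dividing the modulus.\<close>

lemma norm_three_four_one:
  fixes z :: complex and t :: real
  assumes t: "0 < t" "t < 1" and z: "z = 0 \<or> norm z = 1"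
  shows "norm (1 - complex_of_real t) ^ 3 * norm (1 - z * t) ^ 4 * norm (1 - z\<^sup>2 * t) \<le> 1"
  using z
proof
  assume "z = 0"
  then have "norm (1 - complex_of_real t) ^ 3 * norm (1 - z * t) ^ 4 * norm (1 - z\<^sup>2 * t)
      = norm (of_real (1 - t) :: complex) ^ 3" by simp
  also have "\<dots> \<le> 1" unfolding norm_of_real using t by (intro power_le_one) auto
  finally show ?thesis .
next
  assume z1: "norm z = 1"
  \<comment> \<open>The term at \<open>k = 0\<close> is 0 since division by 0 gives 0, in agreement
    with the missing constant term of the logarithm series.\<close>
  have ser: "(\<lambda>k. - (t ^ k * Re (w ^ k) / k)) sums ln (norm (1 - w * t))" and pos: "0 < norm (1 - w * t)"
    if w: "norm w = 1" for w :: complex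
  proof -
    have lt: "norm (w * t) < 1" using w t by (simp add: norm_mult)
    then have ne: "1 - w * t \<noteq> 0" by (metis norm_one less_irrefl right_minus_eq)
    then show "0 < norm (1 - w * t)" by simp
    have "(\<lambda>k. - ((w * t) ^ k / of_nat k)) sums ln (1 - w * t)"
      using Ln_series'[of "-(w * t)"] lt by simp
    then have "(\<lambda>k. Re (- ((w * t) ^ k / of_nat k))) sums Re (ln (1 - w * t))"
      by (rule sums_Re)
    moreover have eq: "Re (- ((w * t) ^ k / of_nat k)) = - (t ^ k * Re (w ^ k) / k)" for k
      by (simp add: power_mult_distrib Re_divide_of_nat flip: of_real_power)
    ultimately show "(\<lambda>k. - (t ^ k * Re (w ^ k) / k)) sums ln (norm (1 - w * t))"
      unfolding eq Re_Ln[OF ne] by simp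
  qed
  have z2: "norm (z\<^sup>2) = 1" using z1 by (simp add: norm_power)
  define s where "s = 3 * ln (norm (1 - 1 * complex_of_real t)) + 4 * ln (norm (1 - z * t)) + ln (norm (1 - z\<^sup>2 * t))"
  have "(\<lambda>k. 3 * - (t ^ k * Re (1 ^ k) / k) + 4 * - (t ^ k * Re (z ^ k) / k) + - (t ^ k * Re ((z\<^sup>2) ^ k) / k)) sums s"
    unfolding s_def by (intro sums_add sums_mult ser z1 z2) simp
  moreover have eq: "3 * - (t ^ k * Re (1 ^ k) / k) + 4 * - (t ^ k * Re (z ^ k) / k) + - (t ^ k * Re ((z\<^sup>2) ^ k) / k)
      = - (t ^ k / k * (2 * (1 + Re (z ^ k))\<^sup>2))" for k
  proof -
    have "norm (z ^ k) = 1" using z1 by (simp add: norm_power)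
    then have "(Re (z ^ k))\<^sup>2 + (Im (z ^ k))\<^sup>2 = 1" by (simp add: cmod_def)
    moreover have "(z\<^sup>2) ^ k = (z ^ k)\<^sup>2" by (simp flip: power_mult add: mult.commute)
    then have "Re ((z\<^sup>2) ^ k) = (Re (z ^ k))\<^sup>2 - (Im (z ^ k))\<^sup>2" by (simp add: Re_power2)
    ultimately have R: "Re ((z\<^sup>2) ^ k) = 2 * (Re (z ^ k))\<^sup>2 - 1" by linarith
    show ?thesis unfolding R
      by (cases "k = 0") (simp_all add: field_simps power2_eq_square)
  qed
  ultimately have "(\<lambda>k. - (t ^ k / k * (2 * (1 + Re (z ^ k))\<^sup>2))) sums s" unfolding eq by simp
  then have "s \<le> 0"
    by (rule sums_le[rotated, OF _ sums_zero]) (use t in simp)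
  moreover have "exp s = norm (1 - complex_of_real t) ^ 3 * norm (1 - z * t) ^ 4 * norm (1 - z\<^sup>2 * t)"
  proof -
    have e: "exp (real k * ln x) = x ^ k" if "0 < x" for k and x :: real
      using that by (simp add: exp_of_nat_mult)
    show ?thesis
      using pos[of 1] pos[OF z1] pos[OF z2] e[of "norm (1 - complex_of_real t)" 3] e[of "norm (1 - z * t)" 4]
      by (simp add: s_def exp_add)
  qed
  ultimately show ?thesis by (metis exp_le_one_iff)
qed


context dirichlet_character
begin

text \<open>The Dirichlet L-function on the real axis. It is meaningful where the series converges:
  for \<open>s > 1\<close>, and for \<open>s > 0\<close> if \<open>\<psi>\<close> is
  nonprincipal.\<close>

definition L :: "real \<Rightarrow> complex" where
  "L s = suminf (\<lambda>j. \<psi> (int (Suc j)) * of_real (real (Suc j) powr -s))"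

definition nonprincipal :: bool where
  "nonprincipal \<longleftrightarrow> (\<exists>u. coprime u (int n) \<and> \<psi> u \<noteq> 1)"

lemma norm_partial_sum_le:
  assumes nonprincipal
  shows "norm (\<Sum>j<m. \<psi> (int (Suc j))) \<le> n"
  using assms norm_sum_le unfolding nonprincipal_def by blast

text \<open>The weights start at 1, so the bound \<open>n\<close> is uniform in \<open>s\<close>;
  this is what controls the L-function of the squared character near 1.\<close>

lemma
  assumes nonprincipal "0 < s"
  shows summable_L: "summable (\<lambda>j. \<psi> (int (Suc j)) * of_real (real (Suc j) powr -s))"
    and norm_L_le: "norm (L s) \<le> n"
    and norm_L_minus_partial_sum_le:
      "norm (L s - (\<Sum>j<k. \<psi> (int (Suc j)) * of_real (real (Suc j) powr -s)))
         \<le> 2 * n * real (Suc k) powr -s"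
proof -
  let ?a = "\<lambda>j. real (Suc j) powr -s"
  have dec: "decseq ?a"
    using assms(2) by (intro decseq_SucI powr_mono2') auto
  have lim: "?a \<longlonglongrightarrow> 0"
    using assms(2) by real_asymp
  note * = summable_mult_decseq[OF norm_partial_sum_le[OF assms(1)] dec lim]
  show "summable (\<lambda>j. \<psi> (int (Suc j)) * of_real (real (Suc j) powr -s))"
    by (rule *(1))
  show "norm (L s) \<le> n" using *(2) by (simp add: L_def)
  show "norm (L s - (\<Sum>j<k. \<psi> (int (Suc j)) * of_real (real (Suc j) powr -s)))
         \<le> 2 * n * real (Suc k) powr -s"
    using *(3)[of k] by (simp add: L_def)
qed

text \<open>A substitute for differentiability at the zero, with a harmless logarithmic loss: both
  series are cut at the same \<open>N\<close> that fixes the exponent, the tails are each at most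
  \<open>2 * n / N\<close>, and the heads are compared term by term through 1 - exp (-x) \<le>
  x.\<close>

lemma norm_L_near_1_le:
  assumes np: nonprincipal and L1: "L 1 = 0" and N: "0 < N"
  shows "norm (L (1 + 1 / real N)) \<le> (4 * n + ln N * (1 + ln N)) / N"
proof -
  define s where "s = 1 + 1 / real N"
  have s: "1 < s" using N by (simp add: s_def)
  define D where "D = (\<lambda>s. \<Sum>j<N. \<psi> (int (Suc j)) * of_real (real (Suc j) powr -s))"
  have tail: "norm (L s' - D s') \<le> 2 * n / N" if "1 \<le> s'" for s'
  proof -
    have "norm (L s' - D s') \<le> 2 * n * real (Suc N) powr -s'"
      unfolding D_def by (rule norm_L_minus_partial_sum_le[OF np]) (use that in simp)
    also have "real (Suc N) powr -s' \<le> real (Suc N) powr -1"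
      by (rule powr_mono) (use that in auto)
    also have "\<dots> \<le> 1 / N" using N by (simp add: powr_minus field_simps)
    finally show ?thesis by (simp add: mult_left_mono)
  qed
  have "norm (D 1 - D s) \<le> (\<Sum>j<N. ln N / N * (1 / real (Suc j)))"
    unfolding D_def sum_subtractf[symmetric]
  proof (rule sum_norm_le)
    fix j assume j: "j \<in> {..<N}"
    let ?m = "real (Suc j)"
    have e: "?m powr -s = ?m powr -1 * ?m powr (-(1 / N))"
      unfolding s_def minus_add_distrib powr_add ..
    have "1 - ?m powr (-(1 / N)) = 1 - exp (-(ln ?m / N))"
      by (simp add: powr_def)
    also have "\<dots> \<le> ln ?m / N" using exp_ge_add_one_self[of "-(ln ?m / N)"] by linarith
    also have "\<dots> \<le> ln N / N" using j by (intro divide_right_mono) auto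
    finally have "(1 / ?m) * (1 - ?m powr (-(1 / N))) \<le> (1 / ?m) * (ln N / N)"
      by (intro mult_left_mono) auto
    then have "?m powr -1 - ?m powr -s \<le> ln N / N * (1 / ?m)"
      unfolding e powr_minus_divide[of _ 1] by (simp add: right_diff_distrib mult.commute)
    moreover have "?m powr -s \<le> ?m powr -1" by (rule powr_mono) (use s in auto)
    ultimately have 1: "norm (?m powr -1 - ?m powr -s) \<le> ln N / N * (1 / ?m)" by simp
    have "\<psi> (int (Suc j)) * of_real (?m powr -1) - \<psi> (int (Suc j)) * of_real (?m powr -s)
        = \<psi> (int (Suc j)) * of_real (?m powr -1 - ?m powr -s)"
      by (simp add: algebra_simps)
    also have "norm \<dots> \<le> 1 * (ln N / N * (1 / ?m))"
      unfolding norm_mult norm_of_real using 1 by (intro mult_mono norm_le_1) auto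
    finally show "norm (\<psi> (int (Suc j)) * of_real (?m powr -1) - \<psi> (int (Suc j)) * of_real (?m powr -s))
        \<le> ln N / N * (1 / ?m)" by simp
  qed
  also have "\<dots> = ln N / N * (\<Sum>j<N. 1 / real (Suc j))"
    by (simp only: sum_distrib_left)
  also have "\<dots> \<le> ln N / N * (1 + ln N)"
    using N by (intro mult_left_mono sum_inverse_le_ln) auto
  finally have head: "norm (D 1 - D s) \<le> ln N / N * (1 + ln N)" .
  have "L s = (L s - D s) - (D 1 - D s) - (L 1 - D 1)"
    using L1 by simp
  also have "norm \<dots> \<le> norm (L s - D s) + norm (D 1 - D s) + norm (L 1 - D 1)"
    by (meson add_right_mono norm_triangle_ineq4 order_trans)
  also have "\<dots> \<le> 2 * n / N + ln N / N * (1 + ln N) + 2 * n / N"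
    using tail[of s] tail[of 1] head s by (intro add_mono) auto
  also have "\<dots> = (4 * n + ln N * (1 + ln N)) / N"
    by (simp add: add_divide_distrib)
  finally show ?thesis unfolding s_def .
qed

lemma euler_product_L:
  assumes "1 < s"
  shows "(\<lambda>N. L s * (\<Prod>p | prime p \<and> p < N. 1 - \<psi> (int p) * of_real (real p powr -s))) \<longlonglongrightarrow> 1"
proof -
  define f where "f = (\<lambda>m::nat. \<psi> (int m) * complex_of_real (real m powr -s))"
  have bd: "norm (f m) \<le> real m powr -s" for m
    using norm_le_1[of "int m"] by (simp add: f_def norm_mult mult_left_le_one_le)
  have "summable (\<lambda>m. real m powr -s)"
    using zeta_series_bound(1)[of "s - 1"] assms
    by (subst summable_Suc_iff[symmetric]) simp
  then have summ: "summable (\<lambda>m. norm (f m))"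
    by (rule summable_comparison_test'[where N = 0]) (use bd in simp)
  have "(\<lambda>N. suminf f * (\<Prod>p | prime p \<and> p < N. 1 - f p)) \<longlonglongrightarrow> 1"
    by (rule euler_product_tendsto[OF _ _ _ summ]) (simp_all add: f_def mult powr_mult)
  moreover have "suminf f = L s"
    using suminf_split_head[OF summable_norm_cancel[OF summ]] by (simp add: f_def L_def)
  ultimately show ?thesis by (simp add: f_def)
qed

text \<open>This is $1 \leq |\zeta(s)|^3 |L(s,\psi)|^4 |L(s,\psi^2)|$ at \<open>s = 1 + 1 / N\<close>, so that a zero of \<open>L\<close> at 1
  would beat the pole of the zeta function.\<close>

lemma one_le_zeta_L_L:
  assumes N: "0 < N" and np2: "dirichlet_character.nonprincipal n (\<lambda>a. (\<psi> a)\<^sup>2)"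
  shows "1 \<le> (1 + real N) ^ 3 * norm (L (1 + 1 / real N)) ^ 4 * n"
proof -
  interpret sq: dirichlet_character n "\<lambda>a. (\<psi> a)\<^sup>2" by (rule square_character)
  define s where "s = 1 + 1 / real N"
  have s: "1 < s" using N by (simp add: s_def)
  define f where "f = (\<lambda>m::nat. complex_of_real (real m powr -s))"
  have "summable (\<lambda>m. real m powr -s)"
    using zeta_series_bound(1)[of "s - 1"] s
    by (subst summable_Suc_iff[symmetric]) simp
  then have summ: "summable (\<lambda>m. norm (f m))" by (simp add: f_def)
  have E0: "(\<lambda>N. suminf f * (\<Prod>p | prime p \<and> p < N. 1 - f p)) \<longlonglongrightarrow> 1"
    by (rule euler_product_tendsto[OF _ _ _ summ]) (simp_all add: f_def powr_mult)
  have "suminf f = suminf (\<lambda>m. f (Suc m))"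
    using suminf_split_head[OF summable_norm_cancel[OF summ]] by (simp add: f_def)
  also have "\<dots> = of_real (suminf (\<lambda>m. real (Suc m) powr -s))"
    unfolding f_def using zeta_series_bound(1)[of "s - 1"] s by (subst suminf_of_real) auto
  finally have "norm (suminf f) = \<bar>suminf (\<lambda>m. real (Suc m) powr -s)\<bar>"
    by (simp only: norm_of_real)
  also have "\<dots> = suminf (\<lambda>m. real (Suc m) powr -s)"
    using zeta_series_bound(1)[of "s - 1"] s by (intro abs_of_nonneg suminf_nonneg) auto
  also have "\<dots> \<le> 1 + real N"
    using zeta_series_bound(2)[of "s - 1"] N by (simp add: s_def)
  finally have Z: "norm (suminf f) \<le> 1 + real N" .
  define P where "P = (\<lambda>h K. \<Prod>p | prime p \<and> p < K. 1 - h p * complex_of_real (real p powr -s))"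
  have P: "norm (P (\<lambda>_. 1) K) ^ 3 * norm (P (\<lambda>p. \<psi> (int p)) K) ^ 4 * norm (P (\<lambda>p. (\<psi> (int p))\<^sup>2) K) \<le> 1" for K
    unfolding P_def prod_norm[symmetric] prod_power_distrib prod.distrib[symmetric]
  proof (rule prod_le_1)
    fix p assume "p \<in> {p. prime p \<and> p < K}"
    then have p: "1 < real p" using prime_gt_1_nat by auto
    have t: "0 < real p powr -s" "real p powr -s < 1"
      using powr_less_mono[of "-s" 0 "real p"] p s by auto
    have z: "\<psi> (int p) = 0 \<or> norm (\<psi> (int p)) = 1"
      using norm_eq_1 eq_0_iff by blast
    show "0 \<le> norm (1 - 1 * complex_of_real (real p powr -s)) ^ 3
        * norm (1 - \<psi> (int p) * complex_of_real (real p powr -s)) ^ 4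
        * norm (1 - (\<psi> (int p))\<^sup>2 * complex_of_real (real p powr -s)) \<and>
       norm (1 - 1 * complex_of_real (real p powr -s)) ^ 3
        * norm (1 - \<psi> (int p) * complex_of_real (real p powr -s)) ^ 4
        * norm (1 - (\<psi> (int p))\<^sup>2 * complex_of_real (real p powr -s)) \<le> 1"
      using norm_three_four_one[OF t z] by simp
  qed
  \<comment> \<open>Each sieved value tends to 1, while \<open>P\<close> bounds the combined prime
    factors by 1; so the product of the unsieved values is at least 1.\<close>
  have "(\<lambda>K. norm (suminf f * P (\<lambda>_. 1) K) ^ 3 * norm (L s * P (\<lambda>p. \<psi> (int p)) K) ^ 4
        * norm (sq.L s * P (\<lambda>p. (\<psi> (int p))\<^sup>2) K)) \<longlonglongrightarrow> norm (1::complex) ^ 3 * norm (1::complex) ^ 4 * norm (1::complex)"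
    unfolding P_def using E0 euler_product_L[OF s] sq.euler_product_L[OF s]
    by (intro tendsto_mult tendsto_power tendsto_norm) (simp_all add: f_def)
  moreover have "norm (suminf f * P (\<lambda>_. 1) K) ^ 3 * norm (L s * P (\<lambda>p. \<psi> (int p)) K) ^ 4
        * norm (sq.L s * P (\<lambda>p. (\<psi> (int p))\<^sup>2) K)
      \<le> (1 + real N) ^ 3 * norm (L s) ^ 4 * n" for K
  proof -
    have "norm (suminf f * P (\<lambda>_. 1) K) ^ 3 * norm (L s * P (\<lambda>p. \<psi> (int p)) K) ^ 4
        * norm (sq.L s * P (\<lambda>p. (\<psi> (int p))\<^sup>2) K)
      = (norm (suminf f) ^ 3 * norm (L s) ^ 4 * norm (sq.L s))
        * (norm (P (\<lambda>_. 1) K) ^ 3 * norm (P (\<lambda>p. \<psi> (int p)) K) ^ 4 * norm (P (\<lambda>p. (\<psi> (int p))\<^sup>2) K))"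
      by (simp add: norm_mult power_mult_distrib algebra_simps)
    also have "\<dots> \<le> norm (suminf f) ^ 3 * norm (L s) ^ 4 * norm (sq.L s)"
      using P[of K] by (intro mult_left_le) auto
    also have "\<dots> \<le> (1 + real N) ^ 3 * norm (L s) ^ 4 * n"
      using Z sq.norm_L_le[OF np2, of s] s by (intro mult_mono power_mono) auto
    finally show ?thesis .
  qed
  ultimately have "norm (1::complex) ^ 3 * norm (1::complex) ^ 4 * norm (1::complex) \<le> (1 + real N) ^ 3 * norm (L s) ^ 4 * n"
    by (intro LIMSEQ_le_const2) auto
  then show ?thesis by (simp add: s_def)
qed

text \<open>At a zero the fourth power decays like N^(-4) up to logarithms, which beats the growth
  N^3 of the zeta factor. Nonprincipality of the square keeps the remaining factor bounded.\<close>

lemma L_1_nonzero_of_complex: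
  assumes np: nonprincipal and np2: "dirichlet_character.nonprincipal n (\<lambda>a. (\<psi> a)\<^sup>2)"
  shows "L 1 \<noteq> 0"
proof
  assume L1: "L 1 = 0"
  let ?B = "\<lambda>N. (1 + real N) ^ 3 * ((4 * real n + ln (real N) * (1 + ln (real N))) / real N) ^ 4 * real n"
  have "?B \<longlonglongrightarrow> 0" using n_gt_1 by real_asymp
  moreover have "1 \<le> ?B N" if "1 \<le> N" for N
  proof -
    have "1 \<le> (1 + real N) ^ 3 * norm (L (1 + 1 / real N)) ^ 4 * n"
      by (rule one_le_zeta_L_L[OF _ np2]) (use that in simp)
    also have "\<dots> \<le> ?B N"
      using norm_L_near_1_le[OF np L1, of N] that
      by (intro mult_right_mono mult_left_mono power_mono) auto
    finally show ?thesis .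
  qed
  ultimately have "(1::real) \<le> 0" by (intro LIMSEQ_le_const) auto
  then show False by simp
qed

end

section \<open>Nonvanishing of L(1) for real characters\<close>

lemma sum_divisors_mult_coprime:
  fixes r :: "nat \<Rightarrow> 'a::comm_semiring_1"
  assumes "coprime a b" "0 < a" "0 < b" and mult: "\<And>x y. r (x * y) = r x * r y"
  shows "(\<Sum>d | d dvd a * b. r d) = (\<Sum>d | d dvd a. r d) * (\<Sum>d | d dvd b. r d)"
proof -
  have "(\<Sum>d | d dvd a * b. r d) = (\<Sum>(x, y)\<in>{d. d dvd a} \<times> {d. d dvd b}. r x * r y)"
  proof (rule sum.reindex_bij_witness[of _ "\<lambda>(x, y). x * y" "\<lambda>d. (gcd d a, gcd d b)"])
    fix d assume "d \<in> {d. d dvd a * b}"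
    then obtain x y where xy: "d = x * y" "x dvd a" "y dvd b"
      using division_decomp[of d a b] by auto
    have "gcd d a * gcd d b = d"
    proof (rule dvd_antisym)
      have "coprime (gcd d a) (gcd d b)"
        using assms(1) by (rule coprime_divisors[rotated 2]) simp_all
      then show "gcd d a * gcd d b dvd d" by (intro divides_mult) simp_all
      show "d dvd gcd d a * gcd d b"
        by (subst xy(1), rule mult_dvd_mono) (use xy in simp_all)
    qed
    then show "(case (gcd d a, gcd d b) of (x, y) \<Rightarrow> x * y) = d"
      and "(case (gcd d a, gcd d b) of (x, y) \<Rightarrow> r x * r y) = r d"
      by (simp_all flip: mult)
  next
    fix xy assume "xy \<in> {d. d dvd a} \<times> {d. d dvd b}"
    then obtain x y where xy: "xy = (x, y)" "x dvd a" "y dvd b" by auto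
    have "coprime a y" "coprime b x"
      using coprime_divisors[of a a y b] coprime_divisors[of b b x a] assms(1) xy
      by (simp_all add: coprime_commute)
    then have "gcd (x * y) a = x" "gcd (x * y) b = y"
      using xy by (simp_all add: gcd_mult_left_right_cancel gcd_mult_left_left_cancel gcd_nat.absorb1)
    then show "(case case xy of (x, y) \<Rightarrow> x * y of d \<Rightarrow> (gcd d a, gcd d b)) = xy"
      using xy by simp
  qed (auto intro: mult_dvd_mono)
  then show ?thesis by (simp add: sum_product sum.cartesian_product)
qed

lemma sum_divisors_prime_power:
  fixes r :: "nat \<Rightarrow> 'a::comm_semiring_1"
  assumes p: "prime p" and r1: "r 1 = 1" and mult: "\<And>x y. r (x * y) = r x * r y"
  shows "(\<Sum>d | d dvd p ^ k. r d) = (\<Sum>i\<le>k. r p ^ i)"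
proof -
  have rp: "r (p ^ i) = r p ^ i" for i by (induction i) (simp_all add: r1[simplified] mult)
  have "inj_on (\<lambda>i. p ^ i) {..k}"
    using prime_gt_1_nat[OF p] by (auto simp: inj_on_def)
  moreover have "{d. d dvd p ^ k} = (\<lambda>i. p ^ i) ` {..k}"
    using divides_primepow_nat[OF p] by auto
  ultimately show ?thesis by (simp add: sum.reindex rp)
qed

text \<open>At a prime power the sum is 1 + e + ... + e^k with e in {-1, 0, 1}: never negative, and
  at least 1 for even k. Multiplicativity does the rest.\<close>

lemma sum_divisors_nonneg:
  fixes r :: "nat \<Rightarrow> real"
  assumes r1: "r 1 = 1" and mult: "\<And>x y. r (x * y) = r x * r y" and vals: "\<And>x. r x \<in> {-1, 0, 1}"
    and "0 < m"
  shows "0 \<le> (\<Sum>d | d dvd m. r d)" and "1 \<le> (\<Sum>d | d dvd m\<^sup>2. r d)"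
proof -
  have pp: "0 \<le> (\<Sum>i\<le>k. r p ^ i)" "even k \<Longrightarrow> 1 \<le> (\<Sum>i\<le>k. r p ^ i)" for p k
  proof -
    have alt: "(\<Sum>i\<le>k. (-1::real) ^ i) = (if even k then 1 else 0)" by (induction k) auto
    have zer: "(\<Sum>i\<le>k. (0::real) ^ i) = 1" by (induction k) auto
    show "0 \<le> (\<Sum>i\<le>k. r p ^ i)" "even k \<Longrightarrow> 1 \<le> (\<Sum>i\<le>k. r p ^ i)"
      using vals[of p] alt zer by auto
  qed
  have "0 \<le> (\<Sum>d | d dvd m. r d) \<and> 1 \<le> (\<Sum>d | d dvd m\<^sup>2. r d)"
    using \<open>0 < m\<close>
  proof (induction m rule: less_induct)
    case (less m)
    show ?case
    proof (cases "m = 1")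
      case True
      then show ?thesis using r1 by simp
    next
      case False
      then obtain p where p: "prime p" "p dvd m" using prime_factor_nat by blast
      define k where "k = multiplicity p m"
      obtain m' where m': "m = p ^ k * m'" "\<not> p dvd m'"
        using multiplicity_decompose'[of m p] p less.prems k_def by (metis not_prime_unit not_gr_zero)
      have k: "0 < k" using m' p(2) by (cases k) auto
      have m'0: "0 < m'" using m' less.prems by (cases m') auto
      have "1 < p ^ k" using k prime_gt_1_nat[OF p(1)] by (metis one_less_power)
      then have lt: "m' < m" using m'(1) m'0 by simp
      have cop: "coprime (p ^ j) (m' ^ i)" for i j
        using p(1) m'(2) by (metis coprime_power_left_iff coprime_power_right_iff prime_imp_coprime)
      have A: "(\<Sum>d | d dvd m ^ i. r d) = (\<Sum>j\<le>k * i. r p ^ j) * (\<Sum>d | d dvd m' ^ i. r d)" for i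
        unfolding m'(1) power_mult_distrib power_mult[symmetric]
          sum_divisors_prime_power[OF p(1) r1 mult, symmetric]
        by (rule sum_divisors_mult_coprime[OF cop _ _ mult]) (use m'0 p in \<open>auto simp: prime_gt_0_nat\<close>)
      note IH = less.IH[OF lt m'0]
      show ?thesis
        using A[of 1] A[of 2] pp(1)[where p=p and k=k] pp(2)[where p=p and k="k * 2"] IH
          mult_mono[of 1 "\<Sum>j\<le>k * 2. r p ^ j" 1 "\<Sum>d | d dvd m'\<^sup>2. r d"] by simp
    qed
  qed
  then show "0 \<le> (\<Sum>d | d dvd m. r d)" and "1 \<le> (\<Sum>d | d dvd m\<^sup>2. r d)" by auto
qed

text \<open>A truncated Lambert series: write N = d k, exchange the order of summation, and sum a
  geometric progression over k up to \<open>M div d\<close>. The truncation is kept exact, so only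
  finite sums are rearranged.\<close>

lemma sum_divisors_power_series:
  fixes r :: "nat \<Rightarrow> real" and t :: real
  assumes "0 < t" "t < 1"
  shows "(\<Sum>N\<in>{1..M}. (\<Sum>d | d dvd N. r d) * t ^ N)
       = (\<Sum>d\<in>{1..M}. r d * ((t ^ d - t ^ (d * (M div d + 1))) / (1 - t ^ d)))"
proof -
  have "(\<Sum>N\<in>{1..M}. (\<Sum>d | d dvd N. r d) * t ^ N) = (\<Sum>(N, d)\<in>Sigma {1..M} (\<lambda>N. {d. d dvd N}). r d * t ^ N)"
    unfolding sum_distrib_right by (subst sum.Sigma) (auto intro!: finite_divisors_nat)
  also have "\<dots> = (\<Sum>(d, k)\<in>Sigma {1..M} (\<lambda>d. {1..M div d}). r d * t ^ (d * k))"
  proof (rule sum.reindex_bij_witness[of _ "\<lambda>(d, k). (d * k, d)" "\<lambda>(N, d). (d, N div d)"])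
    fix x assume x: "x \<in> Sigma {1..M} (\<lambda>d. {1..M div d})"
    then obtain d k where dk: "x = (d, k)" "1 \<le> d" "1 \<le> k" "k \<le> M div d" by auto
    then have "d * k \<le> M" by (metis dual_order.trans mult_le_mono2 times_div_less_eq_dividend)
    then show "(case x of (d, k) \<Rightarrow> (d * k, d)) \<in> Sigma {1..M} (\<lambda>N. {d. d dvd N})"
      using dk by (auto simp: Suc_le_eq)
  next
    fix x assume x: "x \<in> Sigma {1..M} (\<lambda>N. {d. d dvd N})"
    then obtain N d where Nd: "x = (N, d)" "1 \<le> N" "N \<le> M" "d dvd N" by auto
    then obtain k where k: "N = d * k" by auto
    show "(case x of (N, d) \<Rightarrow> (d, N div d)) \<in> Sigma {1..M} (\<lambda>d. {1..M div d})"
    proof -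
      have "0 < d" "0 < k" using Nd k by (auto intro!: Nat.gr0I)
      moreover from this have "d \<le> M" using Nd(3) k by (metis dual_order.trans dvd_imp_le dvd_triv_left nat_0_less_mult_iff)
      moreover have "k \<le> M div d"
        using Nd(3) k \<open>0 < d\<close> by (simp add: less_eq_div_iff_mult_less_eq mult.commute)
      ultimately show ?thesis using Nd(1) k by simp
    qed
  qed auto
  also have "\<dots> = (\<Sum>d\<in>{1..M}. r d * (\<Sum>k\<in>{1..M div d}. t ^ (d * k)))"
    by (subst sum.Sigma[symmetric]) (auto simp: sum_distrib_left)
  also have "(\<Sum>k\<in>{1..K}. t ^ (d * k)) = (t ^ d - t ^ (d * (K + 1))) / (1 - t ^ d)"
    if "1 \<le> d" for d K
  proof -
    have lt: "t ^ d < 1" using assms that by (simp add: power_less_one_iff)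
    have geo: "(1 - x) * (\<Sum>k\<in>{1..K}. x ^ k) = x - x ^ (K + 1)" for x :: real
    proof (induction K)
      case (Suc K)
      have split: "(1 - x) * (\<Sum>k\<in>{1..Suc K}. x ^ k) = (1 - x) * (\<Sum>k\<in>{1..K}. x ^ k) + (1 - x) * x ^ Suc K"
        by (simp add: distrib_left)
      show ?case unfolding split Suc.IH by (simp add: algebra_simps)
    qed simp
    have "(1 - t ^ d) * (\<Sum>k\<in>{1..K}. (t ^ d) ^ k) = t ^ d - (t ^ d) ^ (K + 1)"
      by (rule geo)
    then show ?thesis using lt by (simp add: power_mult[symmetric] power_add field_simps)
  qed
  then have "(\<Sum>d\<in>{1..M}. r d * (\<Sum>k\<in>{1..M div d}. t ^ (d * k)))
     = (\<Sum>d\<in>{1..M}. r d * ((t ^ d - t ^ (d * (M div d + 1))) / (1 - t ^ d)))"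
    by (intro sum.cong) auto
  finally show ?thesis .
qed

text \<open>With S_m = 1 + t + ... + t^(m-1), the value \<open>b m\<close> is (1/m - t^m / S_m) / (1
  - t), and its decrease amounts to m (m+1) t^m \<le> S_m S_(m+1).\<close>

lemma lambert_difference_decseq:
  fixes t :: real
  assumes t: "0 < t" "t < 1"
  defines "b \<equiv> \<lambda>m::nat. 1 / (real m * (1 - t)) - t ^ m / (1 - t ^ m)"
  shows "b (Suc (Suc m)) \<le> b (Suc m)"
proof -
  define S where "S = (\<lambda>m. \<Sum>i<m. t ^ i)"
  define u where "u = sqrt t"
  have u: "0 < u" "u < 1" "t = u\<^sup>2" using t by (auto simp: u_def)
  have S: "1 - t ^ m = (1 - t) * S m" for m
    unfolding S_def using one_diff_power_eq[of t m] by simp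
  \<comment> \<open>Pair the exponents i and m - 1 - i: by the inequality of arithmetic and
    geometric means each pair contributes at least 2 u^(m-1).\<close>
  have low: "real m * u ^ (m - 1) \<le> S m" for m
  proof -
    have two: "2 * u ^ (m - 1) \<le> t ^ i + t ^ (m - 1 - i)" if "i < m" for i
    proof -
      have "0 \<le> (u ^ i - u ^ (m - 1 - i))\<^sup>2" by simp
      also have "\<dots> = t ^ i + t ^ (m - 1 - i) - 2 * (u ^ i * u ^ (m - 1 - i))"
        by (simp add: u(3) power2_diff power_mult[symmetric] mult.commute)
      also have "u ^ i * u ^ (m - 1 - i) = u ^ (m - 1)"
        using that by (simp flip: power_add)
      finally show ?thesis by simp
    qed
    have "(\<Sum>i<m. t ^ (m - 1 - i)) = S m"
      unfolding S_def using sum.nat_diff_reindex[of "\<lambda>i. t ^ i" m] by simp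
    then have "2 * S m = (\<Sum>i<m. t ^ i + t ^ (m - 1 - i))"
      by (simp add: sum.distrib S_def)
    also have "\<dots> \<ge> (\<Sum>i<m. 2 * u ^ (m - 1))"
      by (rule sum_mono) (use two in auto)
    finally show ?thesis by simp
  qed
  let ?m = "Suc m"
  \<comment> \<open>The exponent is weakened from \<open>m\<close> to \<open>?m\<close> so that the
    two lower bounds multiply to an integral power of \<open>t\<close>.\<close>
  have S1: "real ?m * u ^ ?m \<le> S ?m"
  proof -
    have "u ^ ?m \<le> u ^ m" using u by (intro power_decreasing) auto
    then have "real ?m * u ^ ?m \<le> real ?m * u ^ m" by (intro mult_left_mono) auto
    also have "\<dots> \<le> S ?m" using low[of ?m] by simp
    finally show ?thesis .
  qed
  have S2: "real (Suc ?m) * u ^ ?m \<le> S (Suc ?m)"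
    using low[of "Suc ?m"] by simp
  have p1: "0 < real ?m * u ^ ?m" and p2: "0 < real (Suc ?m) * u ^ ?m" using u by auto
  have pos: "0 < S ?m" "0 < S (Suc ?m)" using S1 S2 p1 p2 by linarith+
  have "(real ?m * u ^ ?m) * (real (Suc ?m) * u ^ ?m) \<le> S ?m * S (Suc ?m)"
    by (rule mult_mono[OF S1 S2]) (use pos p2 in linarith)+
  also have "(real ?m * u ^ ?m) * (real (Suc ?m) * u ^ ?m) = real ?m * real (Suc ?m) * t ^ ?m"
    by (simp add: u(3) power_mult[symmetric] algebra_simps flip: power_add power_mult_distrib mult_2)
  finally have prod: "real ?m * real (Suc ?m) * t ^ ?m \<le> S ?m * S (Suc ?m)" .
  have "x / y \<le> 1 / a" if "a * x \<le> y" "0 < a" "0 < y" for x y a :: real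
    using that by (simp add: field_simps)
  from this[OF prod] have main: "t ^ ?m / (S ?m * S (Suc ?m)) \<le> 1 / (real ?m * real (Suc ?m))"
    using pos by simp
  have Ss: "S (Suc ?m) = S ?m + t ^ ?m" by (simp add: S_def)
  have Sr: "t * S ?m = S (Suc ?m) - 1"
    unfolding S_def by (subst (2) sum.lessThan_Suc_shift) (simp add: sum_distrib_left del: sum.lessThan_Suc)
  have diff: "t ^ ?m / S ?m - t ^ (Suc ?m) / S (Suc ?m) = t ^ ?m / (S ?m * S (Suc ?m))"
  proof -
    have "t ^ ?m / S ?m - t ^ (Suc ?m) / S (Suc ?m) = t ^ ?m * (S (Suc ?m) - t * S ?m) / (S ?m * S (Suc ?m))"
      using pos by (simp add: field_simps)
    then show ?thesis unfolding Sr by simp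
  qed
  have "1 / real ?m - 1 / real (Suc ?m) = 1 / (real ?m * real (Suc ?m))"
    by (simp add: field_simps)
  then have "1 / real (Suc ?m) - t ^ (Suc ?m) / S (Suc ?m) \<le> 1 / real ?m - t ^ ?m / S ?m"
    using main diff by linarith
  moreover have "b k = (1 / real k - t ^ k / S k) / (1 - t)" if "0 < k" "0 < S k" for k
    unfolding b_def S by (simp add: diff_divide_distrib mult.commute)
  ultimately show ?thesis
    using pos t by (simp add: divide_right_mono)
qed


context dirichlet_character
begin

text \<open>Monsky's argument: as \<open>t\<close> tends to 1 from below, the Lambert series of \<open>\<psi>\<close> tends to infinity because its
  coefficients (the divisor sums of \<open>\<psi>\<close>) are nonnegative and at least 1 at squares; but if \<open>L 1 = 0\<close>
  then it differs only in sign from the sum of \<open>\<psi> m * b m\<close>, which is bounded by partial summation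
  because \<open>b\<close> decreases.\<close>

lemma L_1_nonzero_of_real:
  assumes np: nonprincipal and real: "\<And>a. coprime a (int n) \<Longrightarrow> (\<psi> a)\<^sup>2 = 1"
  shows "L 1 \<noteq> 0"
proof
  assume L1: "L 1 = 0"
  define r where "r = (\<lambda>m::nat. Re (\<psi> (int m)))"
  have vals: "\<psi> a \<in> {-1, 0, 1}" for a
    using real[of a] eq_0_iff[of a] by (auto simp: power2_eq_1_iff)
  have r_eq: "\<psi> (int m) = of_real (r m)" and r_vals: "r m \<in> {-1, 0, 1}" for m
    using vals[of "int m"] by (auto simp: r_def)
  have r1: "r 1 = 1" by (simp add: r_def)
  have "complex_of_real (r (x * y)) = of_real (r x * r y)" for x y
    using mult[of "int x" "int y"] by (simp flip: r_eq)
  then have r_mult: "r (x * y) = r x * r y" for x y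
    using of_real_eq_iff by blast
  define A where "A = (\<lambda>m. \<Sum>d | d dvd m. r d)"
  have A_nonneg: "0 \<le> A m" and A_square: "1 \<le> A (m\<^sup>2)" if "0 < m" for m
    unfolding A_def by (rule sum_divisors_nonneg[OF r1 r_mult r_vals that])+
  have shift: "(\<Sum>m\<in>{1..M}. h m) = (\<Sum>j<M. h (Suc j))" for h :: "nat \<Rightarrow> real" and M
    by (rule sum.reindex_bij_witness[of _ Suc "\<lambda>m. m - 1"]) auto
  have L_lim: "(\<lambda>M. \<Sum>m\<in>{1..M}. r m / m) \<longlonglongrightarrow> 0"
  proof -
    have "(\<lambda>M. \<Sum>j<M. \<psi> (int (Suc j)) * of_real (real (Suc j) powr -1)) \<longlonglongrightarrow> 0"
      using summable_LIMSEQ[OF summable_L[OF np, of 1]] L1 unfolding L_def by simp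
    then have "(\<lambda>M. Re (\<Sum>j<M. \<psi> (int (Suc j)) * of_real (real (Suc j) powr -1))) \<longlonglongrightarrow> Re 0"
      by (rule tendsto_Re)
    moreover have "Re (\<Sum>j<M. \<psi> (int (Suc j)) * of_real (real (Suc j) powr -1)) = (\<Sum>m\<in>{1..M}. r m / m)" for M
      unfolding shift Re_sum r_eq by (simp add: powr_minus_divide del: of_nat_Suc)
    ultimately show ?thesis by simp
  qed
  \<comment> \<open>The geometric quotient at d is 1 / (d (1 - t)) - \<open>b d\<close> -
    \<open>e d\<close>. The three parts give the partial sum for \<open>L 1\<close>, a sum bounded
    by \<open>n\<close> through partial summation, and the truncation error.\<close>
  have bound: "(\<Sum>N\<in>{1..M}. A N * t ^ N)
      \<le> (1 / (1 - t)) * (\<Sum>m\<in>{1..M}. r m / m) + n + M * t ^ M / (1 - t)"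
    if t: "0 < t" "t < 1" for t M
  proof -
    define b where "b = (\<lambda>m::nat. 1 / (real m * (1 - t)) - t ^ m / (1 - t ^ m))"
    define e where "e = (\<lambda>d. t ^ (d * (M div d + 1)) / (1 - t ^ d))"
    have td: "t ^ d \<le> t" if "1 \<le> d" for d using t power_decreasing[of 1 d t] that by simp
    have "(\<Sum>N\<in>{1..M}. A N * t ^ N) = (\<Sum>d\<in>{1..M}. r d * (1 / (real d * (1 - t)) - b d - e d))"
      unfolding A_def sum_divisors_power_series[OF t] by (simp add: b_def e_def diff_divide_distrib)
    also have "\<dots> = (1 / (1 - t)) * (\<Sum>m\<in>{1..M}. r m / m) - (\<Sum>m\<in>{1..M}. r m * b m) - (\<Sum>d\<in>{1..M}. r d * e d)"
      by (simp add: sum_subtractf right_diff_distrib sum_distrib_left mult.commute)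
    finally have eq: "(\<Sum>N\<in>{1..M}. A N * t ^ N) = \<dots>" .
    have dec: "decseq (\<lambda>j. b (Suc j))"
      unfolding b_def by (intro decseq_SucI lambert_difference_decseq t)
    have b_lim: "b \<longlonglongrightarrow> 0"
    proof -
      have 1: "(\<lambda>m. t ^ m) \<longlonglongrightarrow> 0" using t by (intro LIMSEQ_realpow_zero) auto
      have "(\<lambda>m. 1 / (1 - t) * (1 / real m) - t ^ m / (1 - t ^ m)) \<longlonglongrightarrow> 1 / (1 - t) * 0 - 0 / (1 - 0)"
        by (intro tendsto_intros 1 lim_1_over_n) simp
      then show ?thesis by (simp add: b_def mult.commute)
    qed
    have b_nonneg: "0 \<le> b (Suc j)" for j
      by (rule decseq_ge[OF dec]) (rule LIMSEQ_Suc[OF b_lim])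
    have "b 1 = 1" using t by (simp add: b_def diff_divide_distrib[symmetric])
    have "\<bar>\<Sum>m\<in>{1..M}. r m * b m\<bar> = norm (\<Sum>j<M. \<psi> (int (Suc j)) * of_real (b (Suc j)))"
      unfolding shift r_eq by (simp only: norm_of_real flip: of_real_mult of_real_sum)
    also have "\<dots> \<le> n * b (Suc 0)"
      by (rule norm_sum_mult_decseq_le[OF norm_partial_sum_le[OF np] dec b_nonneg])
    finally have mid: "\<bar>\<Sum>m\<in>{1..M}. r m * b m\<bar> \<le> n" using \<open>b 1 = 1\<close> by simp
    have "\<bar>\<Sum>d\<in>{1..M}. r d * e d\<bar> \<le> (\<Sum>d\<in>{1..M}. t ^ M / (1 - t))"
    proof (rule order_trans[OF sum_abs sum_mono])
      fix d assume d: "d \<in> {1..M}"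
      have "M \<le> d * (M div d + 1)"
        using d dividend_less_div_times[of d M] by (simp add: algebra_simps)
      then have "t ^ (d * (M div d + 1)) \<le> t ^ M" using t by (intro power_decreasing) auto
      then have "e d \<le> t ^ M / (1 - t)"
        unfolding e_def using t td[of d] d by (intro frac_le) auto
      moreover have "0 \<le> e d" unfolding e_def using t td[of d] d by (intro divide_nonneg_nonneg) auto
      moreover have "\<bar>r d\<bar> \<le> 1" using r_vals[of d] by auto
      ultimately show "\<bar>r d * e d\<bar> \<le> t ^ M / (1 - t)"
        by (simp add: abs_mult) (metis abs_ge_zero mult_left_le_one_le order_trans)
    qed
    then have "\<bar>\<Sum>d\<in>{1..M}. r d * e d\<bar> \<le> M * t ^ M / (1 - t)" by simp
    then show ?thesis using eq mid by linarith
  qed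
  \<comment> \<open>Letting \<open>M\<close> grow removes the truncation error and, since
    \<open>L 1 = 0\<close>, also the term with the factor 1 / (1 - t), which would be unbounded as t
    tends to 1.\<close>
  have squares: "(\<Sum>j\<in>{1..J}. t ^ (j\<^sup>2)) \<le> n" if t: "0 < t" "t < 1" for t :: real and J
  proof (rule LIMSEQ_le_const)
    have 1: "(\<lambda>M. real M * t ^ M) \<longlonglongrightarrow> 0"
      using powser_times_n_limit_0[of t] t by simp
    have "(\<lambda>M. (1 / (1 - t)) * (\<Sum>m\<in>{1..M}. r m / m) + n + (M * t ^ M) / (1 - t)) \<longlonglongrightarrow> 1 / (1 - t) * 0 + n + 0 / (1 - t)"
      by (intro tendsto_intros L_lim 1) (use t in simp)
    then show "(\<lambda>M. (1 / (1 - t)) * (\<Sum>m\<in>{1..M}. r m / m) + n + (M * t ^ M) / (1 - t)) \<longlonglongrightarrow> n"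
      by simp
    have "(\<Sum>j\<in>{1..J}. t ^ (j\<^sup>2)) \<le> (1 / (1 - t)) * (\<Sum>m\<in>{1..M}. r m / m) + n + M * t ^ M / (1 - t)"
      if "J\<^sup>2 \<le> M" for M
    proof -
      have "(\<Sum>j\<in>{1..J}. t ^ (j\<^sup>2)) \<le> (\<Sum>j\<in>{1..J}. A (j\<^sup>2) * t ^ (j\<^sup>2))"
        using A_square t by (intro sum_mono) simp
      also have "\<dots> = (\<Sum>N\<in>(\<lambda>j. j\<^sup>2) ` {1..J}. A N * t ^ N)"
        by (subst sum.reindex) (auto simp: inj_on_def)
      also have "\<dots> \<le> (\<Sum>N\<in>{1..M}. A N * t ^ N)"
      proof (rule sum_mono2)
        show "(\<lambda>j. j\<^sup>2) ` {1..J} \<subseteq> {1..M}"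
          using that by (auto intro: order_trans[OF power_mono])
      qed (use A_nonneg t in auto)
      also note bound[OF t]
      finally show ?thesis .
    qed
    then show "\<exists>N. \<forall>M\<ge>N. (\<Sum>j\<in>{1..J}. t ^ (j\<^sup>2)) \<le> (1 / (1 - t)) * (\<Sum>m\<in>{1..M}. r m / m) + n + (M * t ^ M) / (1 - t)"
      by blast
  qed
  \<comment> \<open>One square more than the uniform bound \<open>n\<close> suffices: each summand
    tends to 1.\<close>
  have "real (Suc n) \<le> n"
  proof (rule tendsto_le[of "at_left 1"])
    have "((\<lambda>t::real. \<Sum>j\<in>{1..Suc n}. t ^ (j\<^sup>2)) \<longlongrightarrow> (\<Sum>j\<in>{1..Suc n}. 1 ^ (j\<^sup>2))) (at_left 1)"
      by (intro tendsto_intros)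
    then show "((\<lambda>t::real. \<Sum>j\<in>{1..Suc n}. t ^ (j\<^sup>2)) \<longlongrightarrow> real (Suc n)) (at_left 1)"
      by simp
    have "eventually (\<lambda>t. t \<in> {0<..<1}) (at_left (1::real))"
      by (rule eventually_at_left_real) simp
    then show "eventually (\<lambda>t::real. (\<Sum>j\<in>{1..Suc n}. t ^ (j\<^sup>2)) \<le> n) (at_left 1)"
      by eventually_elim (rule squares, auto)
  qed auto
  then show False by simp
qed

theorem L_1_nonzero:
  assumes nonprincipal
  shows "L 1 \<noteq> 0"
proof (cases "dirichlet_character.nonprincipal n (\<lambda>a. (\<psi> a)\<^sup>2)")
  case True
  then show ?thesis using L_1_nonzero_of_complex assms by blast
next
  case False
  then show ?thesis
    using L_1_nonzero_of_real[OF assms] dirichlet_character.nonprincipal_def[OF square_character] by blast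
qed

end

section \<open>Generalized Bernoulli numbers\<close>

lemma sum_int_atLeastLessThan: "(\<Sum>a\<in>{0..<int n}. F a) = (\<Sum>j<n. F (int j))"
  by (rule sum.reindex_bij_witness[of _ int nat]) auto

text \<open>1 - e^(i \<theta>) has modulus 2 sin (\<theta> / 2) and argument (\<theta> - pi) / 2,
  which lies in the principal range of \<open>Ln\<close>. This is the origin of the
  sawtooth.\<close>

lemma Im_Ln_one_minus_cis:
  assumes "0 < \<theta>" "\<theta> < 2 * pi"
  shows "Im (Ln (1 - cis \<theta>)) = (\<theta> - pi) / 2"
proof -
  define s where "s = 2 * sin (\<theta> / 2)"
  have s: "0 < s" using assms by (auto simp: s_def intro: sin_gt_zero)
  have c: "cos \<theta> = 1 - 2 * (sin (\<theta> / 2))\<^sup>2" and si: "sin \<theta> = 2 * sin (\<theta> / 2) * cos (\<theta> / 2)"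
    using cos_double_sin[of "\<theta> / 2"] sin_double[of "\<theta> / 2"] by simp_all
  have co: "cos ((\<theta> - pi) / 2) = sin (\<theta> / 2)" "sin ((\<theta> - pi) / 2) = - cos (\<theta> / 2)"
    by (simp_all add: diff_divide_distrib cos_diff sin_diff)
  have "exp (Complex (ln s) ((\<theta> - pi) / 2)) = 1 - cis \<theta>"
    using s by (simp add: exp_eq_polar complex_eq_iff co c si s_def power2_eq_square)
  then have "Ln (1 - cis \<theta>) = Complex (ln s) ((\<theta> - pi) / 2)"
    by (rule Ln_unique) (use assms pi_gt_zero in auto)
  then show ?thesis by simp
qed

section \<open>Additive characters, Gauss sums and the logarithmic formula for L(1)\<close>

context dirichlet_character
begin

definition e :: "int \<Rightarrow> complex" where
  "e k = cis (2 * pi * of_int k / of_nat n)"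

lemma e_add: "e (a + b) = e a * e b"
  by (simp add: e_def cis_mult add_divide_distrib distrib_left)

lemma e_eq_1_iff: "e k = 1 \<longleftrightarrow> int n dvd k"
proof
  assume "e k = 1"
  then have "exp (\<i> * of_real (2 * pi * of_int k / of_nat n)) = 1"
    by (simp only: e_def cis_conv_exp)
  then obtain j :: int where "2 * pi * of_int k / of_nat n = of_int (2 * j) * pi"
    unfolding exp_eq_1 by auto
  then have "real_of_int k = real_of_int (int n * j)" using n_gt_1 by (simp add: field_simps)
  then show "int n dvd k" unfolding of_int_eq_iff by simp
next
  assume "int n dvd k"
  then obtain j where "k = int n * j" by auto
  then have "2 * pi * of_int k / of_nat n = 2 * pi * of_int j" using n_gt_1 by simp
  then show "e k = 1" unfolding e_def by (simp only: cis_multiple_2pi Ints_of_int)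
qed

lemma e_mult_nat: "e (k * int j) = e k ^ j"
  unfolding e_def Complex.DeMoivre by (rule arg_cong[where f = cis]) simp

lemma e_cong: "[a = b] (mod int n) \<Longrightarrow> e a = e b"
  using e_add[of b "a - b"] e_eq_1_iff[of "a - b"] by (simp add: cong_iff_dvd_diff)

lemma e_mod: "e (a mod int n) = e a"
  by (rule e_cong) (simp add: cong_def)

lemma norm_e [simp]: "norm (e k) = 1" by (simp add: e_def)

lemma sum_e: "(\<Sum>b\<in>{0..<int n}. e (k * b)) = (if int n dvd k then of_nat n else 0)"
proof -
  have "(\<Sum>b\<in>{0..<int n}. e (k * b)) = (\<Sum>j<n. e k ^ j)"
    by (simp add: sum_int_atLeastLessThan e_mult_nat)
  moreover have "e k ^ n = 1"
    using e_eq_1_iff[of "k * int n"] by (simp add: e_mult_nat)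
  moreover have "(1 - e k) * (\<Sum>j<n. e k ^ j) = 1 - e k ^ n"
    by (rule one_diff_power_eq[symmetric])
  ultimately show ?thesis using e_eq_1_iff[of k] by auto
qed

text \<open>The finite Fourier transform of \<open>\<psi>\<close>. The minus sign leaves positive
  powers of \<open>e b\<close> in the inversion formula, where they become logarithm series.\<close>

definition gauss :: "int \<Rightarrow> complex" where
  "gauss b = (\<Sum>a\<in>{0..<int n}. \<psi> a * e (- (a * b)))"

lemma gauss_mult:
  assumes "coprime u (int n)"
  shows "\<psi> u * gauss (u * b) = gauss b"
proof -
  have "\<psi> u * gauss (u * b) = (\<Sum>a\<in>{0..<int n}. \<psi> (u * a) * e (- ((u * a) * b)))"
    by (simp add: gauss_def sum_distrib_left mult mult_ac)
  also have "\<dots> = gauss b"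
    unfolding gauss_def
  proof (rule sum_mult_mod[OF assms])
    fix a
    have "e (- (a mod int n * b)) = e (- (a * b))"
      by (rule e_cong) (subst cong_minus_minus_iff, simp add: cong_def mod_mult_left_eq)
    then show "\<psi> (a mod int n) * e (- (a mod int n * b)) = \<psi> a * e (- (a * b))"
      by (simp add: periodic)
  qed (use n_gt_1 in simp)
  finally show ?thesis .
qed

lemma gauss_cong: "[a = b] (mod int n) \<Longrightarrow> gauss a = gauss b"
  unfolding gauss_def
  by (intro sum.cong refl arg_cong2[where f = "(*)"] e_cong)
    (simp add: cong_minus_minus_iff cong_scalar_left)

lemma fourier_inversion: "of_nat n * \<psi> m = (\<Sum>b\<in>{0..<int n}. gauss b * e (m * b))"
proof -
  have "(\<Sum>b\<in>{0..<int n}. gauss b * e (m * b))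
      = (\<Sum>b\<in>{0..<int n}. \<Sum>a\<in>{0..<int n}. \<psi> a * e ((m - a) * b))"
    unfolding gauss_def sum_distrib_right
  proof (intro sum.cong refl)
    fix a b
    have "e (- (a * b)) * e (m * b) = e ((m - a) * b)"
      unfolding e_add[symmetric] by (simp add: left_diff_distrib)
    then show "\<psi> a * e (- (a * b)) * e (m * b) = \<psi> a * e ((m - a) * b)"
      by (simp only: mult.assoc)
  qed
  also have "\<dots> = (\<Sum>a\<in>{0..<int n}. \<psi> a * (\<Sum>b\<in>{0..<int n}. e ((m - a) * b)))"
    by (subst sum.swap) (simp add: sum_distrib_left)
  also have "\<dots> = (\<Sum>a\<in>{0..<int n}. if a = m mod int n then of_nat n * \<psi> m else 0)"
  proof (rule sum.cong[OF refl])
    fix a assume a: "a \<in> {0..<int n}"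
    have "int n dvd m - a \<longleftrightarrow> a = m mod int n"
      using a by (auto simp: mod_eq_dvd_iff[symmetric])
    then show "\<psi> a * (\<Sum>b\<in>{0..<int n}. e ((m - a) * b)) = (if a = m mod int n then of_nat n * \<psi> m else 0)"
      unfolding sum_e by (auto simp: periodic)
  qed
  also have "\<dots> = of_nat n * \<psi> m" using n_gt_1 by simp
  finally show ?thesis by simp
qed

text \<open>If d = gcd(b, n), then u b = b modulo n says u = 1 modulo n / d. So this is the usual
  condition that \<open>\<psi>\<close> is nontrivial on the units that are 1 modulo any given proper
  divisor of n, in the form that makes separated sums vanish at nonunits.\<close>

definition primitive :: bool where
  "primitive \<longleftrightarrow> (\<forall>b. \<not> coprime b (int n) \<longrightarrow> (\<exists>u. coprime u (int n) \<and> [u * b = b] (mod int n) \<and> \<psi> u \<noteq> 1))"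

lemma primitive_imp_nonprincipal: "primitive \<Longrightarrow> nonprincipal"
  using n_gt_1 unfolding primitive_def nonprincipal_def by (auto dest: spec[of _ 0])

text \<open>At a unit this is a substitution. At a nonunit the unit that fixes \<open>b\<close>
  multiplies \<open>gauss b\<close> by a number other than 1 without changing it, so both sides are
  0.\<close>

lemma gauss_eq:
  assumes primitive
  shows "gauss b = cnj (\<psi> b) * gauss 1"
proof (cases "coprime b (int n)")
  case True
  then have "\<psi> b * cnj (\<psi> b) = 1"
    using norm_eq_1[OF True] by (simp add: complex_norm_square[symmetric])
  moreover have "\<psi> b * gauss b = gauss 1" using gauss_mult[OF True, of 1] by simp
  ultimately show ?thesis by (metis mult.assoc mult.commute mult_1)
next
  case False
  then obtain u where u: "coprime u (int n)" "[u * b = b] (mod int n)" "\<psi> u \<noteq> 1"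
    using assms unfolding primitive_def by blast
  have "\<psi> u * gauss b = gauss b" using gauss_mult[OF u(1), of b] gauss_cong[OF u(2)] by simp
  then have "gauss b = 0" using u(3) by simp
  moreover have "\<psi> b = 0" using False eq_0_iff by simp
  ultimately show ?thesis by simp
qed

text \<open>Abel's limit theorem: the tails are bounded by \<open>2 * n / real (Suc k)\<close> for
  all radii in (0, 1] at once, so only the continuity of a finite sum is left.\<close>

lemma abel_limit_L_1:
  assumes nonprincipal
  shows "((\<lambda>r. suminf (\<lambda>j. \<psi> (int (Suc j)) * of_real (r ^ Suc j / real (Suc j)))) \<longlongrightarrow> L 1) (at_left 1)"
proof (rule tendstoI)
  fix \<epsilon> :: real assume \<epsilon>: "0 < \<epsilon>"
  define S where "S = (\<lambda>r. suminf (\<lambda>j. \<psi> (int (Suc j)) * of_real (r ^ Suc j / real (Suc j))))"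
  define H where "H = (\<lambda>k r. \<Sum>j<k. \<psi> (int (Suc j)) * of_real (r ^ Suc j / real (Suc j)))"
  have L1: "L 1 = S 1"
    unfolding L_def S_def by (simp add: powr_minus_divide del: of_nat_Suc)
  have tail: "norm (S r - H k r) \<le> 2 * n / real (Suc k)" if r: "0 < r" "r \<le> 1" for r k
  proof -
    have dec: "decseq (\<lambda>j. r ^ Suc j / real (Suc j))"
      by (intro decseq_SucI frac_le power_decreasing) (use r in auto)
    have "(\<lambda>j. r ^ Suc j / real (Suc j)) \<longlonglongrightarrow> 0"
    proof (rule tendsto_sandwich[OF _ _ tendsto_const])
      show "(\<lambda>j. 1 / real (Suc j)) \<longlonglongrightarrow> 0" by (rule LIMSEQ_Suc[OF lim_1_over_n])
      show "\<forall>\<^sub>F j in sequentially. r ^ Suc j / real (Suc j) \<le> 1 / real (Suc j)"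
        using r by (intro always_eventually allI divide_right_mono power_le_one) auto
    qed (use r in simp)
    note summable_mult_decseq(3)[OF norm_partial_sum_le[OF assms] dec this, of k]
    then have "norm (S r - H k r) \<le> 2 * n * (r ^ Suc k / real (Suc k))"
      unfolding S_def H_def by simp
    also have "\<dots> \<le> 2 * n * (1 / real (Suc k))"
      using r by (intro mult_left_mono divide_right_mono power_le_one) auto
    finally show ?thesis by simp
  qed
  obtain k :: nat where k: "6 * real n / \<epsilon> < k" using reals_Archimedean2 by blast
  have "2 * n / real (Suc k) < \<epsilon> / 3"
  proof -
    have "6 * real n < \<epsilon> * k" using k \<epsilon> by (simp add: field_simps)
    also have "\<dots> \<le> \<epsilon> * real (Suc k)" using \<epsilon> by simp
    finally show ?thesis by (simp add: field_simps)
  qed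
  note small = this
  have "(H k \<longlongrightarrow> H k 1) (at_left 1)"
    unfolding H_def by (intro tendsto_intros) auto
  then have "eventually (\<lambda>r. dist (H k r) (H k 1) < \<epsilon> / 3) (at_left 1)"
    by (rule tendstoD) (use \<epsilon> in simp)
  moreover have "eventually (\<lambda>t. t \<in> {0<..<1}) (at_left (1::real))"
    by (rule eventually_at_left_real) simp
  ultimately show "eventually (\<lambda>r. dist (S r) (L 1) < \<epsilon>) (at_left 1)"
    unfolding L1
  proof eventually_elim
    case (elim r)
    have "S r - S 1 = (S r - H k r) + (H k r - H k 1) - (S 1 - H k 1)" by simp
    also have "norm \<dots> \<le> norm (S r - H k r) + norm (H k r - H k 1) + norm (S 1 - H k 1)"
      by (meson add_right_mono norm_triangle_ineq norm_triangle_ineq4 order_trans)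
    also have "\<dots> < \<epsilon> / 3 + \<epsilon> / 3 + \<epsilon> / 3"
      using tail[of r k] tail[of 1 k] small elim by (simp add: dist_norm)
    finally show ?case by (simp add: dist_norm)
  qed
qed

lemma e_ne_1_imp:
  assumes "e b \<noteq> 1"
  shows "1 - e b \<notin> \<real>\<^sub>\<le>\<^sub>0"
proof -
  have "Re (e b) < 1"
  proof (rule ccontr)
    assume "\<not> Re (e b) < 1"
    then have "Re (e b) = 1" using complex_Re_le_cmod[of "e b"] by simp
    moreover from this have "Im (e b) = 0"
      using norm_e[of b] cmod_power2[of "e b"] by simp
    ultimately show False using assms by (simp add: complex_eq_iff)
  qed
  then show ?thesis by (simp add: complex_nonpos_Reals_iff)
qed

text \<open>Inside the unit disc, Fourier inversion turns the series into a combination of logarithm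
  series, one for each residue; then the radius tends to 1.\<close>

lemma L_1_eq_sum_Ln:
  assumes prim: primitive
  shows "of_nat n * L 1 = - (gauss 1 * (\<Sum>b\<in>{0..<int n}. cnj (\<psi> b) * Ln (1 - e b)))"
proof -
  define S where "S = (\<lambda>r. suminf (\<lambda>j. \<psi> (int (Suc j)) * of_real (r ^ Suc j / real (Suc j))))"
  define R where "R = (\<lambda>r. \<Sum>b\<in>{0..<int n}. gauss b * Ln (1 - of_real r * e b))"
  have S: "of_nat n * S r = - R r" if r: "0 < r" "r < 1" for r
  proof -
    have ser: "(\<lambda>m. (of_real r * e b) ^ m / of_nat m) sums - Ln (1 - of_real r * e b)" for b
      using sums_minus[OF Ln_series'[of "- (of_real r * e b)"]] r by (simp add: norm_mult)
    have "(\<lambda>m. \<Sum>b\<in>{0..<int n}. gauss b * ((of_real r * e b) ^ m / of_nat m)) sums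
        (\<Sum>b\<in>{0..<int n}. gauss b * - Ln (1 - of_real r * e b))"
      by (intro sums_sum sums_mult ser)
    moreover have "(\<Sum>b\<in>{0..<int n}. gauss b * ((of_real r * e b) ^ m / of_nat m))
        = of_nat n * (\<psi> (int m) * of_real (r ^ m / real m))" for m
    proof -
      have e: "e (int m * b) = e b ^ m" for b
        using e_mult_nat[of b m] by (simp add: mult.commute)
      have "(\<Sum>b\<in>{0..<int n}. gauss b * ((of_real r * e b) ^ m / of_nat m))
        = (\<Sum>b\<in>{0..<int n}. gauss b * e (int m * b)) * of_real (r ^ m / real m)"
        unfolding sum_distrib_right by (rule sum.cong[OF refl]) (simp add: power_mult_distrib e)
      then show ?thesis by (simp add: fourier_inversion[symmetric])
    qed
    ultimately have "(\<lambda>m. of_nat n * (\<psi> (int m) * of_real (r ^ m / real m))) sums - R r"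
      by (simp add: R_def sum_negf)
    then have "(\<lambda>m. of_nat n * (\<psi> (int (Suc m)) * of_real (r ^ Suc m / real (Suc m)))) sums - R r"
      by (subst sums_Suc_iff) simp
    then have s: "(\<lambda>m. \<psi> (int (Suc m)) * of_real (r ^ Suc m / real (Suc m))) sums (- R r / of_nat n)"
      using n_gt_1 by (intro sums_mult_D) auto
    show ?thesis unfolding S_def sums_unique[OF s, symmetric] using n_gt_1 by simp
  qed
  have "((\<lambda>r. of_nat n * S r) \<longlongrightarrow> of_nat n * L 1) (at_left 1)"
    unfolding S_def by (intro tendsto_intros abel_limit_L_1 primitive_imp_nonprincipal prim)
  moreover have "eventually (\<lambda>t. t \<in> {0<..<1}) (at_left (1::real))"
    by (rule eventually_at_left_real) simp
  then have "eventually (\<lambda>r. of_nat n * S r = - R r) (at_left 1)"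
    by eventually_elim (rule S, auto)
  ultimately have 1: "((\<lambda>r. - R r) \<longlongrightarrow> of_nat n * L 1) (at_left 1)"
    by (rule Lim_transform_eventually)
  \<comment> \<open>The logarithm is singular in the limit only where \<open>e b = 1\<close>, and
    there \<open>gauss b = 0\<close>.\<close>
  have "((\<lambda>r. gauss b * Ln (1 - of_real r * e b)) \<longlongrightarrow> gauss b * Ln (1 - of_real 1 * e b)) (at_left 1)" for b
  proof (cases "e b = 1")
    case True
    then have "int n dvd b" by (simp add: e_eq_1_iff)
    then have "\<psi> b = 0" using periodic[of b] by simp
    then show ?thesis using gauss_eq[OF prim, of b] by simp
  next
    case False
    have "1 - of_real 1 * e b \<notin> \<real>\<^sub>\<le>\<^sub>0" using e_ne_1_imp[OF False] by simp
    then show ?thesis by (intro tendsto_intros)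
  qed
  then have "(R \<longlongrightarrow> R 1) (at_left 1)"
    unfolding R_def by (intro tendsto_sum)
  then have "((\<lambda>r. - R r) \<longlongrightarrow> - R 1) (at_left 1)" by (rule tendsto_minus)
  with 1 have "of_nat n * L 1 = - R 1" by (intro tendsto_unique[OF _ 1]) simp_all
  also have "R 1 = gauss 1 * (\<Sum>b\<in>{0..<int n}. cnj (\<psi> b) * Ln (1 - e b))"
    unfolding R_def sum_distrib_left
    by (rule sum.cong[OF refl]) (subst gauss_eq[OF prim], simp)
  finally show ?thesis .
qed

text \<open>Replacing b by -b conjugates the logarithm and changes the sign of the character, so the
  real parts of the logarithms cancel. The term \<open>b = 0\<close> is 0 on both sides.\<close>

lemma sum_cnj_mult_Ln:
  assumes odd: "\<psi> (-1) = -1"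
  shows "(\<Sum>b\<in>{0..<int n}. cnj (\<psi> b) * Ln (1 - e b))
       = \<i> * of_real pi * (\<Sum>b\<in>{0..<int n}. cnj (\<psi> b) * of_real (of_int b / of_nat n - 1 / 2))"
proof -
  define T where "T = (\<Sum>b\<in>{0..<int n}. cnj (\<psi> b) * Ln (1 - e b))"
  have "T = (\<Sum>b\<in>{0..<int n}. cnj (\<psi> (-1 * b)) * Ln (1 - e (-1 * b)))"
    unfolding T_def
    by (rule sum_mult_mod[symmetric])
      (use n_gt_1 in \<open>simp_all add: periodic e_mod\<close>)
  also have "\<dots> = (\<Sum>b\<in>{0..<int n}. - (cnj (\<psi> b) * cnj (Ln (1 - e b))))"
  proof (rule sum.cong[OF refl])
    fix b assume b: "b \<in> {0..<int n}"
    show "cnj (\<psi> (-1 * b)) * Ln (1 - e (-1 * b)) = - (cnj (\<psi> b) * cnj (Ln (1 - e b)))"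
    proof (cases "b = 0")
      case False
      then have "\<not> int n dvd b" using b by (auto dest: zdvd_imp_le)
      then have "e b \<noteq> 1" by (simp add: e_eq_1_iff)
      then have "cnj (Ln (1 - e b)) = Ln (cnj (1 - e b))"
        using e_ne_1_imp by (intro cnj_Ln) auto
      moreover have "cnj (e b) = e (- b)" by (simp add: e_def cis_cnj)
      moreover have "\<psi> (-1 * b) = - \<psi> b" unfolding mult odd by simp
      ultimately show ?thesis by simp
    qed simp
  qed
  finally have "2 * T = (\<Sum>b\<in>{0..<int n}. cnj (\<psi> b) * Ln (1 - e b)) + (\<Sum>b\<in>{0..<int n}. - (cnj (\<psi> b) * cnj (Ln (1 - e b))))"
    by (simp add: T_def)
  also have "\<dots> = (\<Sum>b\<in>{0..<int n}. 2 * (\<i> * of_real pi * (cnj (\<psi> b) * of_real (of_int b / of_nat n - 1 / 2))))"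
    unfolding sum.distrib[symmetric]
  proof (rule sum.cong[OF refl])
    fix b assume b: "b \<in> {0..<int n}"
    show "cnj (\<psi> b) * Ln (1 - e b) + - (cnj (\<psi> b) * cnj (Ln (1 - e b)))
        = 2 * (\<i> * of_real pi * (cnj (\<psi> b) * of_real (of_int b / of_nat n - 1 / 2)))"
    proof (cases "b = 0")
      case False
      have "Im (Ln (1 - e b)) = (2 * pi * of_int b / of_nat n - pi) / 2"
        unfolding e_def by (rule Im_Ln_one_minus_cis) (use b False in \<open>auto simp: field_simps\<close>)
      also have "\<dots> = pi * (of_int b / of_nat n - 1 / 2)" by (simp add: field_simps)
      finally have im: "Im (Ln (1 - e b)) = pi * (of_int b / of_nat n - 1 / 2)" .
      have "Ln (1 - e b) - cnj (Ln (1 - e b)) = 2 * \<i> * of_real (pi * (of_int b / of_nat n - 1 / 2))"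
        unfolding im[symmetric] by (simp add: complex_eq_iff)
      then have "cnj (\<psi> b) * (Ln (1 - e b) - cnj (Ln (1 - e b))) = cnj (\<psi> b) * (2 * \<i> * of_real (pi * (of_int b / of_nat n - 1 / 2)))"
        by simp
      then show ?thesis by (simp add: algebra_simps)
    qed simp
  qed
  finally have "T = \<i> * of_real pi * (\<Sum>b\<in>{0..<int n}. cnj (\<psi> b) * of_real (of_int b / of_nat n - 1 / 2))"
    unfolding sum_distrib_left[symmetric] by simp
  then show ?thesis unfolding T_def .
qed

lemma primitive_cnj:
  assumes primitive
  shows "dirichlet_character.primitive n (\<lambda>a. cnj (\<psi> a))"
proof -
  interpret c: dirichlet_character n "\<lambda>a. cnj (\<psi> a)" by (rule cnj_character)
  show ?thesis using assms unfolding c.primitive_def primitive_def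
    by simp
qed

text \<open>For the conjugate character, \<open>n\<close> times the nonzero value at 1 of its
  L-function is a product with this sum as a factor.\<close>

theorem generalized_bernoulli_nonzero:
  assumes primitive and "\<psi> (-1) = -1"
  shows "(\<Sum>b\<in>{0..<int n}. \<psi> b * of_real (of_int b / of_nat n - 1 / 2)) \<noteq> 0"
proof -
  interpret c: dirichlet_character n "\<lambda>a. cnj (\<psi> a)" by (rule cnj_character)
  have "c.L 1 \<noteq> 0"
    by (rule c.L_1_nonzero[OF c.primitive_imp_nonprincipal[OF primitive_cnj[OF assms(1)]]])
  then show ?thesis
    using c.L_1_eq_sum_Ln[OF primitive_cnj[OF assms(1)]] c.sum_cnj_mult_Ln n_gt_1 assms(2)
    by auto
qed

end

section \<open>Characters modulo a prime\<close>

text \<open>The discrete logarithm to a primitive root \<open>g\<close>. An arbitrary exponent is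
  chosen, so everything holds modulo \<open>p - 1\<close> only.\<close>

lemma prime_discrete_log:
  fixes p :: nat
  assumes p: "prime p"
  obtains l :: "int \<Rightarrow> nat" and g :: int where
    "\<And>a b. coprime a (int p) \<Longrightarrow> coprime b (int p) \<Longrightarrow> [l a = l b] (mod p - 1) \<longleftrightarrow> [a = b] (mod int p)"
    "\<And>a b. coprime a (int p) \<Longrightarrow> coprime b (int p) \<Longrightarrow> [l (a * b) = l a + l b] (mod p - 1)"
    "coprime g (int p)" "[l g = 1] (mod p - 1)"
proof -
  have p1: "1 < p" using p by (rule prime_gt_1_nat)
  obtain g where g: "residue_primroot p g" using prime_primitive_root_exists[OF p1 p] by blast
  have cop: "coprime p g" and ord: "ord p g = p - 1"
    using g p by (auto simp: residue_primroot_def totient_prime)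
  have ex: "\<exists>i. [int g ^ i = a] (mod int p)" if "coprime a (int p)" for a
  proof -
    have b: "int (nat (a mod int p)) = a mod int p" using p1 by simp
    have "coprime (int (nat (a mod int p))) (int p)" unfolding b using that p1 by simp
    then have "coprime (nat (a mod int p)) p" by (simp only: coprime_int_iff)
    moreover from this have "nat (a mod int p) \<noteq> 0" using p1 by (metis coprime_0_left_iff nat_dvd_1_iff_1 less_irrefl)
    moreover have "nat (a mod int p) < p"
      using b pos_mod_bound[of "int p" a] p1 by linarith
    ultimately have "nat (a mod int p) \<in> totatives p" by (simp add: totatives_def)
    then obtain i where "nat (a mod int p) = g ^ i mod p"
      using residue_primroot_is_generator[OF p1 g] by (auto simp: bij_betw_def)
    then have "int (nat (a mod int p)) = int (g ^ i mod p)" by (rule arg_cong)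
    then have "a mod int p = int g ^ i mod int p" unfolding b by (simp add: zmod_int)
    then show ?thesis by (auto simp: cong_def)
  qed
  define l where "l = (\<lambda>a. SOME i. [int g ^ i = a] (mod int p))"
  have l: "[int g ^ l a = a] (mod int p)" if "coprime a (int p)" for a
    unfolding l_def by (rule someI_ex[OF ex[OF that]])
  have pw: "[int g ^ i = int g ^ j] (mod int p) \<longleftrightarrow> [i = j] (mod p - 1)" for i j
    using order_divides_expdiff[OF cop, of i j] ord cong_int_iff[of "g ^ i" "g ^ j" p] by simp
  have 1: "[l a = l b] (mod p - 1) \<longleftrightarrow> [a = b] (mod int p)" if "coprime a (int p)" "coprime b (int p)" for a b
    unfolding pw[symmetric] using l[OF that(1)] l[OF that(2)] by (meson cong_sym cong_trans)
  have 2: "[l (a * b) = l a + l b] (mod p - 1)" if "coprime a (int p)" "coprime b (int p)" for a b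
  proof -
    have "[int g ^ l (a * b) = a * b] (mod int p)" using that by (intro l) simp
    moreover have "[int g ^ (l a + l b) = a * b] (mod int p)"
      unfolding power_add using l that by (intro cong_mult) auto
    ultimately show ?thesis unfolding pw[symmetric] by (meson cong_sym cong_trans)
  qed
  have g': "coprime (int g) (int p)" using cop by (simp add: coprime_commute)
  have 3: "[l (int g) = 1] (mod p - 1)" using l[OF g'] pw[of "l (int g)" 1] by simp
  show thesis by (rule that[OF 1 2 g' 3])
qed

text \<open>The characters are a \<mapsto> z^(j l(a)) with z a primitive root of unity of order p -
  1. The principal character, j = 0, is left out of the geometric sum; hence the final - 1.\<close>

lemma prime_characters:
  fixes p :: nat
  assumes p: "prime p" "2 < p"
  obtains \<xi> :: "nat \<Rightarrow> int \<Rightarrow> complex" where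
    "\<And>j. dirichlet_character p (\<xi> j)"
    "\<And>j. j \<in> {1..<p - 1} \<Longrightarrow> \<exists>g. coprime g (int p) \<and> \<xi> j g \<noteq> 1"
    "\<And>a. coprime a (int p) \<Longrightarrow>
       (\<Sum>j\<in>{1..<p - 1}. \<xi> j a) = (if [a = 1] (mod int p) then of_nat (p - 1) else 0) - 1"
proof -
  obtain l g where l1: "\<And>a b. coprime a (int p) \<Longrightarrow> coprime b (int p) \<Longrightarrow> [l a = l b] (mod p - 1) \<longleftrightarrow> [a = b] (mod int p)"
    and l2: "\<And>a b. coprime a (int p) \<Longrightarrow> coprime b (int p) \<Longrightarrow> [l (a * b) = l a + l b] (mod p - 1)"
    and g: "coprime g (int p)" "[l g = 1] (mod p - 1)"
    using prime_discrete_log[OF p(1)] by blast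
  define z where "z = cis (2 * pi / real (p - 1))"
  have z: "z ^ i = z ^ j \<longleftrightarrow> [i = j] (mod p - 1)" for i j
  proof -
    have r: "z ^ i = cis (2 * pi * real i / real (p - 1))" for i
      unfolding z_def Complex.DeMoivre by (rule arg_cong[where f = cis]) simp
    have "z ^ i = z ^ j \<longleftrightarrow> z ^ i / z ^ j = 1" by (simp add: z_def)
    also have "z ^ i / z ^ j = cis (2 * pi * (real i - real j) / real (p - 1))"
      unfolding r cis_divide by (rule arg_cong[where f = cis]) (simp add: diff_divide_distrib right_diff_distrib)
    also have "\<dots> = 1 \<longleftrightarrow> (\<exists>m::int. 2 * pi * (real i - real j) / real (p - 1) = of_int (2 * m) * pi)"
      unfolding cis_conv_exp exp_eq_1 by simp
    also have "\<dots> \<longleftrightarrow> (\<exists>m::int. int i - int j = int (p - 1) * m)"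
    proof (rule ex_cong1)
      fix m :: int
      have "2 * pi * (real i - real j) / real (p - 1) = of_int (2 * m) * pi
          \<longleftrightarrow> real i - real j = real (p - 1) * of_int m"
      proof -
        have "2 * pi * (real i - real j) / real (p - 1) = of_int (2 * m) * pi
            \<longleftrightarrow> (2 * pi) * (real i - real j) = (2 * pi) * (real (p - 1) * of_int m)"
          using p by (subst nonzero_divide_eq_eq) (auto simp: mult_ac)
        then show ?thesis by (simp only: mult_left_cancel[of "2 * pi"] pi_neq_zero mult_eq_0_iff) simp
      qed
      also have "\<dots> \<longleftrightarrow> real_of_int (int i - int j) = real_of_int (int (p - 1) * m)" by simp
      also have "\<dots> \<longleftrightarrow> int i - int j = int (p - 1) * m" by (simp only: of_int_eq_iff)
      finally show "2 * pi * (real i - real j) / real (p - 1) = of_int (2 * m) * pi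
          \<longleftrightarrow> int i - int j = int (p - 1) * m" .
    qed
    also have "\<dots> \<longleftrightarrow> [int i = int j] (mod int (p - 1))"
      unfolding cong_iff_dvd_diff dvd_def ..
    also have "\<dots> \<longleftrightarrow> [i = j] (mod p - 1)" by (rule cong_int_iff)
    finally show ?thesis .
  qed
  have z0: "z \<noteq> 0" by (simp add: z_def)
  define \<xi> where "\<xi> = (\<lambda>j a. if coprime a (int p) then (z ^ l a) ^ j else 0)"
  have "dirichlet_character p (\<xi> j)" for j
  proof
    show "1 < p" using p by simp
    show "\<xi> j (a * b) = \<xi> j a * \<xi> j b" for a b
    proof (cases "coprime a (int p) \<and> coprime b (int p)")
      case True
      then have "z ^ l (a * b) = z ^ l a * z ^ l b"
        unfolding power_add[symmetric] z using l2 by blast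
      then show ?thesis using True by (simp add: \<xi>_def power_mult_distrib)
    qed (auto simp: \<xi>_def)
    show "\<xi> j (a mod int p) = \<xi> j a" for a
    proof (cases "coprime a (int p)")
      case True
      then have "z ^ l (a mod int p) = z ^ l a"
        unfolding z using p by (subst l1) (auto simp: cong_def)
      then show ?thesis using True p by (simp add: \<xi>_def)
    qed (use p in \<open>simp add: \<xi>_def\<close>)
    show "\<xi> j a = 0 \<longleftrightarrow> \<not> coprime a (int p)" for a using z0 by (simp add: \<xi>_def)
  qed
  moreover have "\<exists>g. coprime g (int p) \<and> \<xi> j g \<noteq> 1" if j: "j \<in> {1..<p - 1}" for j
  proof (intro exI conjI)
    have "z ^ l g = z ^ 1" unfolding z by (rule g(2))
    then have "\<xi> j g = z ^ j" using g by (simp add: \<xi>_def)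
    moreover have "z ^ j \<noteq> z ^ 0" unfolding z using j by (auto simp: cong_def)
    ultimately show "\<xi> j g \<noteq> 1" by simp
  qed (rule g(1))
  moreover have "(\<Sum>j\<in>{1..<p - 1}. \<xi> j a) = (if [a = 1] (mod int p) then of_nat (p - 1) else 0) - 1"
    if a: "coprime a (int p)" for a
  proof -
    have "[l (1 * 1) = l 1 + l 1] (mod p - 1)" by (rule l2) auto
    then have l0: "[l 1 = 0] (mod p - 1)"
      using cong_add_lcancel_nat[of "l 1" "l 1" 0 "p - 1"] by (simp add: cong_sym_eq)
    have iff: "z ^ l a = 1 \<longleftrightarrow> [a = 1] (mod int p)"
    proof -
      have "z ^ l a = 1 \<longleftrightarrow> [l a = 0] (mod p - 1)" using z[of "l a" 0] by simp
      also have "\<dots> \<longleftrightarrow> [l a = l 1] (mod p - 1)" using l0 by (meson cong_sym cong_trans)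
      also have "\<dots> \<longleftrightarrow> [a = 1] (mod int p)" using a by (intro l1) auto
      finally show ?thesis .
    qed
    have "(\<Sum>j<p - 1. \<xi> j a) = (\<Sum>j<p - 1. (z ^ l a) ^ j)" using a by (simp add: \<xi>_def)
    moreover have "(1 - z ^ l a) * (\<Sum>j<p - 1. (z ^ l a) ^ j) = 1 - (z ^ l a) ^ (p - 1)"
      by (rule one_diff_power_eq[symmetric])
    moreover have "(z ^ l a) ^ (p - 1) = 1"
      using z[of "l a * (p - 1)" 0] by (simp add: power_mult cong_def)
    ultimately have "(\<Sum>j<p - 1. \<xi> j a) = (if [a = 1] (mod int p) then of_nat (p - 1) else 0)"
      unfolding iff[symmetric] by auto
    moreover have "(\<Sum>j<p - 1. \<xi> j a) = \<xi> 0 a + (\<Sum>j\<in>{1..<p - 1}. \<xi> j a)"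
    proof -
      have "{..<p - 1} = insert 0 {1..<p - 1}" using p by auto
      then show ?thesis by simp
    qed
    moreover have "\<xi> 0 a = 1" using a by (simp add: \<xi>_def)
    ultimately show ?thesis by (simp add: algebra_simps)
  qed
  ultimately show thesis by (rule that)
qed

text \<open>The sawtooth with value -1/2, not 0, at multiples of \<open>n\<close>; it is odd only
  away from them.\<close>

definition saw :: "nat \<Rightarrow> int \<Rightarrow> real" where
  "saw n x = of_int (x mod int n) / of_nat n - 1 / 2"

lemma saw_cong: "[x = y] (mod int n) \<Longrightarrow> saw n x = saw n y"
  by (simp add: saw_def cong_def)

lemma saw_minus:
  assumes "\<not> int n dvd x" "0 < n"
  shows "saw n (- x) = - saw n x"
proof -
  have "(- x) mod int n = int n - x mod int n"
    using assms by (simp add: zmod_zminus1_eq_if dvd_eq_mod_eq_0)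
  then show ?thesis using assms(2) by (simp add: saw_def diff_divide_distrib)
qed

context dirichlet_character
begin

text \<open>\<open>T\<close> separates exactly like a Gauss sum, at nonunits thanks to primitivity,
  and \<open>T 1\<close> is the generalized Bernoulli sum.\<close>

lemma sum_character_eq_0:
  fixes m :: "'i \<Rightarrow> int"
  assumes prim: primitive and odd: "\<psi> (-1) = -1"
    and H: "\<And>u. coprime u (int n) \<Longrightarrow> (\<Sum>i\<in>I. saw n (u * m i)) = 0"
  shows "(\<Sum>i\<in>I. \<psi> (m i)) = 0"
proof -
  define T where "T = (\<lambda>x. \<Sum>g\<in>{0..<int n}. \<psi> g * of_real (saw n (g * x)))"
  have Tmult: "\<psi> u * T (u * x) = T x" if u: "coprime u (int n)" for u x
  proof -
    have "\<psi> u * T (u * x) = (\<Sum>g\<in>{0..<int n}. \<psi> (u * g) * of_real (saw n ((u * g) * x)))"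
      by (simp add: T_def sum_distrib_left mult mult_ac)
    also have "\<dots> = T x"
      unfolding T_def
    proof (rule sum_mult_mod[OF u])
      fix g
      have "saw n (g mod int n * x) = saw n (g * x)"
        by (rule saw_cong) (simp add: cong_def mod_mult_left_eq)
      then show "\<psi> (g mod int n) * of_real (saw n (g mod int n * x)) = \<psi> g * of_real (saw n (g * x))"
        by (simp add: periodic)
    qed (use n_gt_1 in simp)
    finally show ?thesis .
  qed
  have Tcong: "T x = T y" if "[x = y] (mod int n)" for x y
    unfolding T_def
    by (intro sum.cong refl arg_cong2[where f = "(*)"] arg_cong[where f = of_real] saw_cong cong_scalar_left that)
  have T: "T x = cnj (\<psi> x) * T 1" for x
  proof (cases "coprime x (int n)")
    case True
    then have "\<psi> x * cnj (\<psi> x) = 1"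
      using norm_eq_1[OF True] by (simp add: complex_norm_square[symmetric])
    moreover have "\<psi> x * T x = T 1" using Tmult[OF True, of 1] by simp
    ultimately show ?thesis by (metis mult.assoc mult.commute mult_1)
  next
    case False
    then obtain u where u: "coprime u (int n)" "[u * x = x] (mod int n)" "\<psi> u \<noteq> 1"
      using prim unfolding primitive_def by blast
    have "\<psi> u * T x = T x" using Tmult[OF u(1), of x] Tcong[OF u(2)] by simp
    then have "T x = 0" using u(3) by simp
    moreover have "\<psi> x = 0" using False eq_0_iff by simp
    ultimately show ?thesis by simp
  qed
  have T1: "T 1 \<noteq> 0"
    using generalized_bernoulli_nonzero[OF prim odd]
    unfolding T_def saw_def by simp
  have "(\<Sum>i\<in>I. T (m i)) = (\<Sum>g\<in>{0..<int n}. \<psi> g * of_real (\<Sum>i\<in>I. saw n (g * m i)))"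
    unfolding T_def by (subst sum.swap) (simp add: sum_distrib_left)
  also have "\<dots> = 0"
  proof (intro sum.neutral ballI)
    fix g
    show "\<psi> g * of_real (\<Sum>i\<in>I. saw n (g * m i)) = 0"
      using H[of g] eq_0_iff[of g] by (cases "coprime g (int n)") simp_all
  qed
  finally have "cnj (\<Sum>i\<in>I. \<psi> (m i)) * T 1 = 0"
    by (simp add: T[of "m _"] sum_distrib_right)
  then show ?thesis using T1 by (simp del: cnj_sum)
qed

text \<open>Even characters cancel and odd ones count twice, so no parity condition remains. Later
  \<open>w\<close> is the inverse of the residue whose class is counted.\<close>

lemma sum_character_odd_part_eq_0:
  fixes m :: "'i \<Rightarrow> int"
  assumes prim: primitive
    and H: "\<And>u. coprime u (int n) \<Longrightarrow> (\<Sum>i\<in>I. saw n (u * m i)) = 0"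
    and w: "coprime w (int n)"
  shows "(\<Sum>i\<in>I. \<psi> (w * m i) - \<psi> (- (w * m i))) = 0"
proof -
  have neg: "\<psi> (- x) = \<psi> (-1) * \<psi> x" for x using mult[of "-1" x] by simp
  have "\<psi> (-1) * \<psi> (-1) = 1" by (simp flip: mult)
  then consider "\<psi> (-1) = 1" | "\<psi> (-1) = -1" by (metis square_eq_1_iff)
  then show ?thesis
  proof cases
    case 1
    then show ?thesis by (simp add: neg[of "w * m _"])
  next
    case 2
    have "(\<Sum>i\<in>I. \<psi> (m i)) = 0" by (rule sum_character_eq_0[OF prim 2 H])
    moreover have "(\<Sum>i\<in>I. \<psi> (w * m i) - \<psi> (- (w * m i))) = 2 * \<psi> w * (\<Sum>i\<in>I. \<psi> (m i))"
      by (simp add: neg[of "w * m _"] 2 mult sum_distrib_left mult_ac)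
    ultimately show ?thesis by simp
  qed
qed

end

section \<open>Character relations modulo a product of two primes\<close>

lemma chinese_remainder_int:
  fixes p q :: nat and a b :: int
  assumes "coprime p q" "0 < p" "0 < q"
  shows "\<exists>x. [x = a] (mod int p) \<and> [x = b] (mod int q)"
proof -
  obtain x where "[x = nat (a mod int p)] (mod p)" "[x = nat (b mod int q)] (mod q)"
    using binary_chinese_remainder_nat[OF assms(1)] by blast
  then have "[int x = int (nat (a mod int p))] (mod int p)" "[int x = int (nat (b mod int q))] (mod int q)"
    by (simp_all only: cong_int_iff)
  then show ?thesis using assms by (intro exI[of _ "int x"]) (simp add: cong_def)
qed

lemma coprime_int_prime_iff:
  fixes p :: nat and b :: int
  assumes "prime p"
  shows "coprime b (int p) \<longleftrightarrow> \<not> int p dvd b"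
proof
  assume "coprime b (int p)"
  then show "\<not> int p dvd b"
    using assms coprime_common_divisor[of b "int p" "int p"] prime_gt_1_nat[of p] by auto
next
  assume "\<not> int p dvd b"
  then have "coprime (int p) b" using assms by (intro prime_imp_coprime) simp_all
  then show "coprime b (int p)" by (simp add: coprime_commute)
qed

lemma primitive_prime_character:
  assumes "prime p" "dirichlet_character p \<psi>" "coprime g (int p)" "\<psi> g \<noteq> 1"
  shows "dirichlet_character.primitive p \<psi>"
  unfolding dirichlet_character.primitive_def[OF assms(2)]
proof (intro allI impI exI conjI)
  fix b assume "\<not> coprime b (int p)"
  then have "int p dvd b"
    using coprime_int_prime_iff[OF assms(1)] by simp
  then show "[g * b = b] (mod int p)" by (simp add: cong_def mod_eq_0_iff_dvd)
qed (use assms in auto)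

text \<open>If p divides b, a unit that is \<open>g\<close> modulo p and 1 modulo q fixes b and has
  value \<open>\<psi> g\<close>; similarly for q.\<close>

lemma primitive_product_character:
  assumes p: "prime p" and q: "prime q" and pq: "p \<noteq> q"
    and c: "dirichlet_character p \<psi>" "dirichlet_character q \<phi>"
    and g: "coprime g (int p)" "\<psi> g \<noteq> 1" and h: "coprime h (int q)" "\<phi> h \<noteq> 1"
  shows "dirichlet_character (p * q) (\<lambda>a. \<psi> a * \<phi> a)"
    and "dirichlet_character.primitive (p * q) (\<lambda>a. \<psi> a * \<phi> a)"
proof -
  interpret P: dirichlet_character p \<psi> by (rule c(1))
  interpret Q: dirichlet_character q \<phi> by (rule c(2))
  have cop: "coprime p q" using p q pq by (rule primes_coprime)
  have pos: "0 < p" "0 < q" using p q by (auto intro: prime_gt_0_nat)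
  show D: "dirichlet_character (p * q) (\<lambda>a. \<psi> a * \<phi> a)"
  proof
    show "1 < p * q" using less_1_mult[OF P.n_gt_1 Q.n_gt_1] .
    show "\<psi> (a * b) * \<phi> (a * b) = \<psi> a * \<phi> a * (\<psi> b * \<phi> b)" for a b
      by (simp add: P.mult Q.mult)
    show "\<psi> (a mod int (p * q)) * \<phi> (a mod int (p * q)) = \<psi> a * \<phi> a" for a
      by (intro arg_cong2[where f = "(*)"] P.cong_eq Q.cong_eq) (simp_all add: cong_def mod_mod_cancel)
    show "\<psi> a * \<phi> a = 0 \<longleftrightarrow> \<not> coprime a (int (p * q))" for a
      by (simp add: P.eq_0_iff Q.eq_0_iff)
  qed
  show "dirichlet_character.primitive (p * q) (\<lambda>a. \<psi> a * \<phi> a)"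
    unfolding dirichlet_character.primitive_def[OF D]
  proof (intro allI impI)
    fix b assume "\<not> coprime b (int (p * q))"
    then have "\<not> coprime b (int p) \<or> \<not> coprime b (int q)" by simp
    then consider "int p dvd b" | "int q dvd b"
      using coprime_int_prime_iff[OF p] coprime_int_prime_iff[OF q] by auto
    then obtain u where u: "coprime u (int p)" "coprime u (int q)" "\<psi> u * \<phi> u \<noteq> 1"
      "[u * b = b] (mod int p)" "[u * b = b] (mod int q)"
    proof cases
      case 1
      obtain u where u: "[u = g] (mod int p)" "[u = 1] (mod int q)"
        using chinese_remainder_int[OF cop pos] by blast
      show thesis
      proof (rule that)
        show "coprime u (int p)" "coprime u (int q)"
          using coprime_cong_cong_left[OF u(1)] coprime_cong_cong_left[OF u(2)] g by simp_all
        show "\<psi> u * \<phi> u \<noteq> 1" using P.cong_eq[OF u(1)] Q.cong_eq[OF u(2)] g by simp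
        show "[u * b = b] (mod int p)" using 1 by (simp add: cong_def mod_eq_0_iff_dvd)
        show "[u * b = b] (mod int q)" using cong_scalar_right[OF u(2), of b] by simp
      qed
    next
      case 2
      obtain u where u: "[u = 1] (mod int p)" "[u = h] (mod int q)"
        using chinese_remainder_int[OF cop pos] by blast
      show thesis
      proof (rule that)
        show "coprime u (int p)" "coprime u (int q)"
          using coprime_cong_cong_left[OF u(1)] coprime_cong_cong_left[OF u(2)] h by simp_all
        show "\<psi> u * \<phi> u \<noteq> 1" using P.cong_eq[OF u(1)] Q.cong_eq[OF u(2)] h by simp
        show "[u * b = b] (mod int q)" using 2 by (simp add: cong_def mod_eq_0_iff_dvd)
        show "[u * b = b] (mod int p)" using cong_scalar_right[OF u(1), of b] by simp
      qed
    qed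
    have "[u * b = b] (mod int p * int q)"
      using u(4,5) by (rule coprime_cong_mult) (use cop in simp)
    then show "\<exists>u. coprime u (int (p * q)) \<and> [u * b = b] (mod int (p * q)) \<and> \<psi> u * \<phi> u \<noteq> 1"
      using u by (intro exI[of _ u]) simp
  qed
qed

text \<open>\<open>delta p x y\<close> is the value at \<open>x / y\<close> of the sum of the nonprincipal characters modulo \<open>p\<close>.\<close>

definition delta :: "nat \<Rightarrow> int \<Rightarrow> int \<Rightarrow> int" where
  "delta p x y = (if [x = y] (mod int p) then int p - 1 else 0) - 1"

lemma cong_mult_inverse_iff:
  fixes y w x :: int
  assumes "[y * w = 1] (mod k)"
  shows "[w * x = 1] (mod k) \<longleftrightarrow> [x = y] (mod k)"
proof
  assume "[w * x = 1] (mod k)"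
  then have "[y * (w * x) = y * 1] (mod k)" by (rule cong_scalar_left)
  moreover have "[y * w * x = 1 * x] (mod k)" by (rule cong_scalar_right[OF assms])
  ultimately show "[x = y] (mod k)" by (simp add: mult.assoc) (meson cong_sym cong_trans)
next
  assume "[x = y] (mod k)"
  then have "[w * x = w * y] (mod k)" by (rule cong_scalar_left)
  then show "[w * x = 1] (mod k)" using assms by (simp add: mult.commute) (meson cong_trans)
qed

lemma cong_minus_left_iff: "[- x = y] (mod k) \<longleftrightarrow> [x = - y] (mod k)" for x y k :: int
  using cong_minus_minus_iff[of x "- y" k] by simp

text \<open>The odd-part relations are summed over all nonprincipal characters with \<open>w\<close>
  inverse to \<open>y\<close>; orthogonality turns the inner sums into \<open>delta\<close>.\<close>

lemma sum_delta_prime_eq_0: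
  fixes m :: "'i \<Rightarrow> int"
  assumes q: "prime q" "2 < q"
    and H: "\<And>u. coprime u (int q) \<Longrightarrow> (\<Sum>i\<in>I. saw q (u * m i)) = 0"
    and cop: "\<And>i. i \<in> I \<Longrightarrow> coprime (m i) (int q)" and y: "coprime y (int q)"
  shows "(\<Sum>i\<in>I. delta q (m i) y - delta q (m i) (- y)) = 0"
proof -
  obtain \<xi> where \<xi>: "\<And>j. dirichlet_character q (\<xi> j)"
    "\<And>j. j \<in> {1..<q - 1} \<Longrightarrow> \<exists>g. coprime g (int q) \<and> \<xi> j g \<noteq> 1"
    "\<And>a. coprime a (int q) \<Longrightarrow>
       (\<Sum>j\<in>{1..<q - 1}. \<xi> j a) = (if [a = 1] (mod int q) then of_nat (q - 1) else 0) - 1"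
    using prime_characters[OF q] by blast
  obtain w where w: "[y * w = 1] (mod int q)" using cong_solve_coprime_int[OF y] by blast
  then have cw: "coprime w (int q)"
    by (auto simp: coprime_iff_invertible_int mult.commute)
  have S: "(\<Sum>j\<in>{1..<q - 1}. \<xi> j (w * x)) = of_int (delta q x y)" if "coprime x (int q)" for x
    using \<xi>(3)[of "w * x"] that cw q by (simp add: cong_mult_inverse_iff[OF w] delta_def of_nat_diff)
  have S': "(\<Sum>j\<in>{1..<q - 1}. \<xi> j (- (w * x))) = of_int (delta q x (- y))" if "coprime x (int q)" for x
    using S[of "- x"] that by (simp add: delta_def cong_minus_left_iff)
  have "complex_of_int (\<Sum>i\<in>I. delta q (m i) y - delta q (m i) (- y))
      = (\<Sum>i\<in>I. \<Sum>j\<in>{1..<q - 1}. \<xi> j (w * m i) - \<xi> j (- (w * m i)))"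
    unfolding of_int_sum
  proof (rule sum.cong[OF refl])
    fix i assume "i \<in> I"
    then show "complex_of_int (delta q (m i) y - delta q (m i) (- y))
        = (\<Sum>j\<in>{1..<q - 1}. \<xi> j (w * m i) - \<xi> j (- (w * m i)))"
      unfolding sum_subtractf of_int_diff using S[OF cop] S'[OF cop] by simp
  qed
  also have "\<dots> = (\<Sum>j\<in>{1..<q - 1}. \<Sum>i\<in>I. \<xi> j (w * m i) - \<xi> j (- (w * m i)))"
    by (rule sum.swap)
  also have "\<dots> = 0"
  proof (rule sum.neutral, rule ballI)
    fix j assume "j \<in> {1..<q - 1}"
    then obtain g where "coprime g (int q)" "\<xi> j g \<noteq> 1" using \<xi>(2) by blast
    then have "dirichlet_character.primitive q (\<xi> j)"
      by (rule primitive_prime_character[OF q(1) \<xi>(1)])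
    then show "(\<Sum>i\<in>I. \<xi> j (w * m i) - \<xi> j (- (w * m i))) = 0"
      by (rule dirichlet_character.sum_character_odd_part_eq_0[OF \<xi>(1) _ H cw])
  qed
  finally show ?thesis by (simp only: of_int_eq_0_iff)
qed

text \<open>The double sum over characters factors into two values of \<open>delta\<close>.
  Orthogonality holds only at units, but nonunits contribute 0 to each product character and can be
  removed beforehand.\<close>

lemma sum_delta_product_eq_0:
  fixes m :: "'i \<Rightarrow> int"
  assumes p: "prime p" "2 < p" and q: "prime q" "2 < q" and pq: "p \<noteq> q" and fin: "finite I"
    and H: "\<And>u. coprime u (int (p * q)) \<Longrightarrow> (\<Sum>i\<in>I. saw (p * q) (u * m i)) = 0"
    and y: "coprime y (int (p * q))"
  shows "(\<Sum>i\<in>{i \<in> I. coprime (m i) (int (p * q))}.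
           delta p (m i) y * delta q (m i) y - delta p (m i) (- y) * delta q (m i) (- y)) = 0"
proof -
  obtain \<xi> where \<xi>: "\<And>j. dirichlet_character p (\<xi> j)"
    "\<And>j. j \<in> {1..<p - 1} \<Longrightarrow> \<exists>g. coprime g (int p) \<and> \<xi> j g \<noteq> 1"
    "\<And>a. coprime a (int p) \<Longrightarrow>
       (\<Sum>j\<in>{1..<p - 1}. \<xi> j a) = (if [a = 1] (mod int p) then of_nat (p - 1) else 0) - 1"
    using prime_characters[OF p] by blast
  obtain \<eta> where \<eta>: "\<And>j. dirichlet_character q (\<eta> j)"
    "\<And>j. j \<in> {1..<q - 1} \<Longrightarrow> \<exists>g. coprime g (int q) \<and> \<eta> j g \<noteq> 1"
    "\<And>a. coprime a (int q) \<Longrightarrow>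
       (\<Sum>j\<in>{1..<q - 1}. \<eta> j a) = (if [a = 1] (mod int q) then of_nat (q - 1) else 0) - 1"
    using prime_characters[OF q] by blast
  obtain w where w: "[y * w = 1] (mod int (p * q))" using cong_solve_coprime_int[OF y] by blast
  then have cw: "coprime w (int (p * q))"
    by (auto simp: coprime_iff_invertible_int mult.commute)
  have wp: "[y * w = 1] (mod int p)" and wq: "[y * w = 1] (mod int q)"
    using cong_modulus_mult[of "y * w" 1 "int p" "int q"] cong_modulus_mult[of "y * w" 1 "int q" "int p"] w
    by (simp_all add: mult.commute)
  have Sp: "(\<Sum>j\<in>{1..<p - 1}. \<xi> j (w * x)) = of_int (delta p x y)" if "coprime x (int (p * q))" for x
    using \<xi>(3)[of "w * x"] that cw p by (simp add: cong_mult_inverse_iff[OF wp] delta_def of_nat_diff)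
  have Sq: "(\<Sum>j\<in>{1..<q - 1}. \<eta> j (w * x)) = of_int (delta q x y)" if "coprime x (int (p * q))" for x
    using \<eta>(3)[of "w * x"] that cw q by (simp add: cong_mult_inverse_iff[OF wq] delta_def of_nat_diff)
  have Sp': "(\<Sum>j\<in>{1..<p - 1}. \<xi> j (- (w * x))) = of_int (delta p x (- y))" if "coprime x (int (p * q))" for x
    using Sp[of "- x"] that by (simp add: delta_def cong_minus_left_iff)
  have Sq': "(\<Sum>j\<in>{1..<q - 1}. \<eta> j (- (w * x))) = of_int (delta q x (- y))" if "coprime x (int (p * q))" for x
    using Sq[of "- x"] that by (simp add: delta_def cong_minus_left_iff)
  let ?A = "{i \<in> I. coprime (m i) (int (p * q))}"
  let ?f = "\<lambda>j k i. \<xi> j (w * m i) * \<eta> k (w * m i) - \<xi> j (- (w * m i)) * \<eta> k (- (w * m i))"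
  have "complex_of_int (\<Sum>i\<in>?A. delta p (m i) y * delta q (m i) y - delta p (m i) (- y) * delta q (m i) (- y))
      = (\<Sum>i\<in>?A. \<Sum>j\<in>{1..<p - 1}. \<Sum>k\<in>{1..<q - 1}. ?f j k i)"
    unfolding of_int_sum
  proof (rule sum.cong[OF refl])
    fix i assume "i \<in> ?A"
    then have c: "coprime (m i) (int (p * q))" by simp
    show "complex_of_int (delta p (m i) y * delta q (m i) y - delta p (m i) (- y) * delta q (m i) (- y))
        = (\<Sum>j\<in>{1..<p - 1}. \<Sum>k\<in>{1..<q - 1}. ?f j k i)"
      unfolding of_int_diff of_int_mult Sp[OF c, symmetric] Sq[OF c, symmetric] Sp'[OF c, symmetric] Sq'[OF c, symmetric]
      by (simp only: sum_product sum_subtractf)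
  qed
  also have "\<dots> = (\<Sum>j\<in>{1..<p - 1}. \<Sum>k\<in>{1..<q - 1}. \<Sum>i\<in>?A. ?f j k i)"
    by (subst sum.swap, rule sum.cong[OF refl], rule sum.swap)
  also have "\<dots> = 0"
  proof (rule sum.neutral, rule ballI, rule sum.neutral, rule ballI)
    fix j k assume "j \<in> {1..<p - 1}" "k \<in> {1..<q - 1}"
    then obtain g h where gh: "coprime g (int p)" "\<xi> j g \<noteq> 1" "coprime h (int q)" "\<eta> k h \<noteq> 1"
      using \<xi>(2)[of j] \<eta>(2)[of k] by auto
    note prim = primitive_product_character[OF p(1) q(1) pq \<xi>(1) \<eta>(1) gh]
    have "(\<Sum>i\<in>I. ?f j k i) = 0"
      using dirichlet_character.sum_character_odd_part_eq_0[OF prim H cw] .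
    moreover have "(\<Sum>i\<in>?A. ?f j k i) = (\<Sum>i\<in>I. ?f j k i)"
    proof (rule sum.mono_neutral_left[OF fin])
      show "\<forall>i\<in>I - ?A. ?f j k i = 0"
      proof
        fix i assume "i \<in> I - ?A"
        then have "\<not> coprime (w * m i) (int (p * q))" "\<not> coprime (- (w * m i)) (int (p * q))" by auto
        then have "\<xi> j (w * m i) * \<eta> k (w * m i) = 0" "\<xi> j (- (w * m i)) * \<eta> k (- (w * m i)) = 0"
          using dirichlet_character.eq_0_iff[OF prim(1)] by blast+
        then show "?f j k i = 0" by (simp only: diff_self)
      qed
    qed auto
    ultimately show "(\<Sum>i\<in>?A. ?f j k i) = 0" by simp
  qed
  finally show ?thesis by (simp only: of_int_eq_0_iff)
qed

section \<open>Four-term relations of the sawtooth function\<close>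

text \<open>Used with \<open>P = p - 1\<close> and \<open>Q = q - 1\<close>; without \<open>Q \<noteq> 8\<close> there is the solution \<open>P = 4\<close>, \<open>Q = 8\<close>, \<open>a = 2\<close>, \<open>b = 3\<close>.\<close>

lemma class_size_equation:
  fixes P Q a b x y :: int
  assumes P: "4 \<le> P" and Q: "6 \<le> Q" "Q \<noteq> 8"
    and eq: "P * Q = P * a + Q * b" and le: "a \<le> x" "b \<le> y" "x \<le> 3" "y \<le> 3" "x + y \<le> 5"
  shows "x = 3 \<and> y = 2"
proof -
  have 1: "Q * b = P * (Q - a)" using eq by (simp add: algebra_simps)
  \<comment> \<open>Since \<open>a\<close> is at most 3, \<open>P * a\<close> is at most half of
    \<open>P * Q\<close>; so \<open>Q * b\<close> is at least half of it and \<open>P\<close> is at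
    most \<open>2 * b\<close>, which leaves finitely many cases.\<close>
  have "P * Q \<le> P * (2 * (Q - a))" using P Q le by (intro mult_left_mono) auto
  then have "Q * P \<le> Q * (2 * b)" using 1 by (simp add: algebra_simps)
  then have "P \<le> 2 * b" using Q by (subst (asm) mult_le_cancel_left_pos) auto
  then have "(P = 4 \<or> P = 5 \<or> P = 6) \<and> (b = 2 \<or> b = 3)" using P le by presburger
  then show ?thesis using \<open>P \<le> 2 * b\<close> 1 Q le by auto
qed

text \<open>If all four terms were congruent to x, their sum would be 4 x, which is not divisible by
  a prime of at least 5.\<close>

lemma card_class_le_3:
  fixes m :: "'i \<Rightarrow> int" and r :: nat
  assumes r: "prime r" "5 \<le> r" and I: "finite I" "card I = 4" "int r dvd (\<Sum>i\<in>I. m i)"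
    and x: "\<not> int r dvd x"
  shows "card {i \<in> I. [m i = x] (mod int r)} \<le> 3"
proof (rule ccontr)
  let ?C = "{i \<in> I. [m i = x] (mod int r)}"
  assume "\<not> card ?C \<le> 3"
  moreover have "card ?C \<le> card I" using I by (intro card_mono) auto
  ultimately have "?C = I" using I by (intro card_subset_eq) auto
  then have "\<And>i. i \<in> I \<Longrightarrow> [m i = x] (mod int r)" by auto
  then have "[(\<Sum>i\<in>I. m i) = (\<Sum>i\<in>I. x)] (mod int r)" by (rule cong_sum)
  then have "int r dvd 4 * x" using I by (simp add: cong_dvd_iff)
  then have "int r dvd 4" using r(1) x by (simp add: prime_dvd_mult_iff)
  then have "int r \<le> 4" by (rule zdvd_imp_le) simp
  then show False using r by simp
qed

text \<open>Equal indices are allowed in \<open>no_pair\<close>, so no \<open>m i\<close> is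
  divisible by \<open>p * q\<close>. The conditions are symmetric in the two primes, so results
  carry over by exchanging them.\<close>

locale saw_relation =
  fixes p q :: nat and I :: "'i set" and m :: "'i \<Rightarrow> int"
  assumes p: "prime p" "5 \<le> p" and q: "prime q" "5 \<le> q" and neq: "p \<noteq> q"
    and I: "finite I" "card I = 4" and sum0: "int (p * q) dvd (\<Sum>i\<in>I. m i)"
    and no_pair: "\<And>i j. i \<in> I \<Longrightarrow> j \<in> I \<Longrightarrow> \<not> int (p * q) dvd m i + m j"
    and rel: "\<And>u. coprime u (int (p * q)) \<Longrightarrow> (\<Sum>i\<in>I. saw (p * q) (u * m i)) = 0"
begin

lemma swapped: "saw_relation q p I m"
  using p q neq I sum0 no_pair rel unfolding saw_relation_def by (simp add: mult.commute)

lemma coprime_pq: "coprime p q"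
  using p q neq by (intro primes_coprime) auto

lemma dvd_both: "int p dvd x \<Longrightarrow> int q dvd x \<Longrightarrow> int (p * q) dvd x"
  using coprime_pq by (simp add: divides_mult)

definition units :: "'i set" where
  "units = {i \<in> I. coprime (m i) (int (p * q))}"

lemma finite_units: "finite units"
  using I by (simp add: units_def)

text \<open>For a unit term y, orthogonality gives P Q N = P a + Q b, where N counts the units among
  the terms congruent to y modulo both primes, and a, b are the differences of the class sizes of y
  and -y. This forces N = 1 and class sizes 3 modulo p and 2 modulo q around every unit, too much
  for four terms.\<close>

lemma units_eq_empty_of_less:
  assumes "p < q"
  shows "units = {}"
proof (rule ccontr)
  assume "units \<noteq> {}"
  define C where "C = (\<lambda>r x. {i \<in> units. [m i = x] (mod int r)})"
  have finC: "finite (C r x)" for r x using finite_units by (simp add: C_def)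
  have sub: "units \<subseteq> I" by (auto simp: units_def)
  have card_units: "card units \<le> 4" using card_mono[OF I(1) sub] I by simp
  have q7: "7 \<le> q"
  proof -
    have "q \<noteq> 6" using q(1) prime_product[of 2 3] by auto
    then show ?thesis using assms p by simp
  qed
  \<comment> \<open>Rules out the exceptional solution of the class size equation, which belongs to
    5 and 9.\<close>
  have q9: "q \<noteq> 9" using q(1) prime_product[of 3 3] by auto
  have key: "card (C p (m i)) = 3 \<and> card (C q (m i)) = 2 \<and> card (C p (m i) \<inter> C q (m i)) = 1"
    if i: "i \<in> units" for i
  proof -
    define y where "y = m i"
    have y: "coprime y (int (p * q))" using i by (simp add: units_def y_def)
    define P Q where "P = int p - 1" and "Q = int q - 1"
    have PQ: "4 \<le> P" "6 \<le> Q" "Q \<noteq> 8" using p q7 q9 by (auto simp: P_def Q_def)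
    have d: "delta p x z = P * of_bool ([x = z] (mod int p)) - 1" "delta q x z = Q * of_bool ([x = z] (mod int q)) - 1" for x z
      by (simp_all add: delta_def P_def Q_def)
    have cnt: "(\<Sum>k\<in>units. of_bool ([m k = z] (mod int r))) = int (card (C r z))" for z r
      using finite_units by (simp add: sum_of_bool_eq C_def Int_def)
    have cnt2: "(\<Sum>k\<in>units. of_bool ([m k = y] (mod int p)) * of_bool ([m k = y] (mod int q))) = int (card (C p y \<inter> C q y))"
      using finite_units by (simp add: sum_of_bool_eq C_def Int_def of_bool_conj[symmetric] conj_ac cong: conj_cong)
    have "0 = (\<Sum>k\<in>units. delta p (m k) y * delta q (m k) y - delta p (m k) (- y) * delta q (m k) (- y))"
      unfolding units_def by (rule sum_delta_product_eq_0[OF p(1) _ q(1) _ neq I(1) rel y, symmetric]) (use p q in auto)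
    \<comment> \<open>The constants of the two expanded products cancel, and the quadratic part at
      \<open>- y\<close> is 0: a term in both classes of \<open>- y\<close> would form a zero pair
      with \<open>m i\<close>.\<close>
    also have "\<dots> = (\<Sum>k\<in>units. P * Q * (of_bool ([m k = y] (mod int p)) * of_bool ([m k = y] (mod int q)))
        - P * (of_bool ([m k = y] (mod int p)) - of_bool ([m k = - y] (mod int p)))
        - Q * (of_bool ([m k = y] (mod int q)) - of_bool ([m k = - y] (mod int q))))"
    proof (rule sum.cong[OF refl])
      fix k assume "k \<in> units"
      then have "\<not> int (p * q) dvd m k + m i" using i by (intro no_pair) (auto simp: units_def)
      then have "\<not> ([m k = - y] (mod int p) \<and> [m k = - y] (mod int q))"
        using dvd_both by (auto simp: cong_iff_dvd_diff y_def)
      then have "of_bool ([m k = - y] (mod int p)) * of_bool ([m k = - y] (mod int q)) = (0::int)"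
        by auto
      then show "delta p (m k) y * delta q (m k) y - delta p (m k) (- y) * delta q (m k) (- y)
        = P * Q * (of_bool ([m k = y] (mod int p)) * of_bool ([m k = y] (mod int q)))
        - P * (of_bool ([m k = y] (mod int p)) - of_bool ([m k = - y] (mod int p)))
        - Q * (of_bool ([m k = y] (mod int q)) - of_bool ([m k = - y] (mod int q)))"
        unfolding d by (auto simp: algebra_simps)
    qed
    also have "\<dots> = P * Q * int (card (C p y \<inter> C q y))
        - P * (int (card (C p y)) - int (card (C p (- y)))) - Q * (int (card (C q y)) - int (card (C q (- y))))"
      by (simp only: sum_subtractf sum_distrib_left[symmetric] cnt cnt2)
    finally have eq: "P * Q * int (card (C p y \<inter> C q y))
        = P * (int (card (C p y)) - int (card (C p (- y)))) + Q * (int (card (C q y)) - int (card (C q (- y))))"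
      by simp
    have i_mem: "i \<in> C p y \<inter> C q y" using i by (simp add: C_def y_def)
    then have N1: "1 \<le> card (C p y \<inter> C q y)"
      using finC by (metis One_nat_def Suc_le_eq card_gt_0_iff empty_iff finite_Int)
    have "card (C p y \<union> C q y) \<le> 4"
      using card_mono[OF finite_units, of "C p y \<union> C q y"] card_units by (auto simp: C_def)
    then have un: "card (C p y) + card (C q y) \<le> card (C p y \<inter> C q y) + 4"
      using card_Un_Int[OF finC finC, of p y q y] by simp
    have le3: "card (C p y) \<le> 3" "card (C q y) \<le> 3"
    proof -
      have c: "\<not> int p dvd y" "\<not> int q dvd y"
        using y coprime_int_prime_iff[OF p(1)] coprime_int_prime_iff[OF q(1)] by simp_all
      have s: "int p dvd (\<Sum>i\<in>I. m i)" "int q dvd (\<Sum>i\<in>I. m i)"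
        using sum0 by (auto intro: dvd_mult_left dvd_mult_right)
      have "card (C r y) \<le> card {i \<in> I. [m i = y] (mod int r)}" for r
        using I by (intro card_mono) (auto simp: C_def units_def)
      then show "card (C p y) \<le> 3" "card (C q y) \<le> 3"
        using card_class_le_3[OF p I s(1) c(1)] card_class_le_3[OF q I s(2) c(2)] by (meson order_trans)+
    qed
    \<comment> \<open>Otherwise the left side of \<open>eq\<close> is at least 2 P Q, while the
      right side is at most 3 P + 3 Q, which is smaller.\<close>
    have N: "card (C p y \<inter> C q y) = 1"
    proof (rule ccontr)
      assume "card (C p y \<inter> C q y) \<noteq> 1"
      then have 1: "P * Q * 2 \<le> P * Q * int (card (C p y \<inter> C q y))"
        using N1 PQ by (intro mult_left_mono) auto
      have 2: "P * Q * int (card (C p y \<inter> C q y)) \<le> P * 3 + Q * 3"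
        unfolding eq using PQ le3 by (intro add_mono mult_left_mono) linarith+
      have "4 * Q \<le> P * Q" "P * 6 \<le> P * Q" using PQ by (auto intro: mult_mono)
      then show False using 1 2 PQ by linarith
    qed
    have "int (card (C p y)) = 3 \<and> int (card (C q y)) = 2"
      by (rule class_size_equation[OF PQ, where a = "int (card (C p y)) - int (card (C p (- y)))"
            and b = "int (card (C q y)) - int (card (C q (- y)))"])
        (use eq N un le3 in simp_all)
    then show ?thesis using N by (simp add: y_def)
  qed
  obtain i where i: "i \<in> units" using \<open>units \<noteq> {}\<close> by blast
  \<comment> \<open>The second member k of the class modulo q lies outside the class modulo p. Its
    own class modulo p also has three members and is disjoint from the first, so there would be six
    units.\<close>
  have "card (C q (m i) - C p (m i)) = 1"
    using key[OF i] card_Diff_subset_Int[of "C q (m i)" "C p (m i)"] finC by (simp add: Int_commute)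
  then obtain k where k: "k \<in> C q (m i)" "k \<notin> C p (m i)"
    by (metis DiffD1 DiffD2 card.empty ex_in_conv zero_neq_one)
  then have ku: "k \<in> units" "\<not> [m k = m i] (mod int p)" by (auto simp: C_def)
  have "C p (m k) \<inter> C p (m i) = {}"
    using ku(2) by (auto simp: C_def) (meson cong_sym cong_trans)
  then have "card (C p (m k) \<union> C p (m i)) = 6"
    using key[OF i] key[OF ku(1)] by (simp add: card_Un_disjoint finC)
  moreover have "card (C p (m k) \<union> C p (m i)) \<le> card units"
    using finite_units by (intro card_mono) (auto simp: C_def)
  ultimately show False using card_units by simp
qed

lemma units_eq_empty: "units = {}"
proof (cases "p < q")
  case True
  then show ?thesis by (rule units_eq_empty_of_less)
next
  case False
  interpret s: saw_relation q p I m by (rule swapped)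
  have "s.units = {}" using False neq by (intro s.units_eq_empty_of_less) simp
  then show ?thesis by (simp add: units_def s.units_def mult.commute)
qed

lemma saw_p_multiple: "saw (p * q) (int p * x) = saw q x"
  using p by (simp add: saw_def mod_mult_mult1)

text \<open>Compare two multipliers that agree modulo q and are 1 and -1 modulo p. Multiples of p do
  not notice the difference, while the other terms, being multiples of q, change the sign of their
  sawtooth values. So the multiples of p satisfy a relation of their own, modulo q after division by
  p.\<close>

lemma no_multiple_of_p: "{i \<in> I. int p dvd m i} = {}"
proof (rule ccontr)
  let ?J = "{i \<in> I. int p dvd m i}"
  assume "?J \<noteq> {}"
  then obtain i0 where i0: "i0 \<in> I" "int p dvd m i0" by blast
  define r where "r = (\<lambda>i. m i div int p)"
  have r: "m i = int p * r i" if "int p dvd m i" for i using that by (simp add: r_def)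
  have not_dvd: "\<not> int (p * q) dvd m i" if "i \<in> I" for i
    using no_pair[OF that that] by (metis dvd_add)
  have pos: "0 < p" "0 < q" using p q by auto
  have q_dvd: "int q dvd m i" if "i \<in> I" "\<not> int p dvd m i" for i
  proof -
    have "\<not> coprime (m i) (int (p * q))" using units_eq_empty that by (auto simp: units_def)
    then show ?thesis
      using that coprime_int_prime_iff[OF p(1)] coprime_int_prime_iff[OF q(1)] by simp
  qed
  have H: "(\<Sum>i\<in>?J. saw q (u * r i)) = 0" if u: "coprime u (int q)" for u
  proof -
    obtain v where v: "[v = 1] (mod int p)" "[v = u] (mod int q)"
      using chinese_remainder_int[OF coprime_pq pos] by blast
    obtain w where w: "[w = -1] (mod int p)" "[w = u] (mod int q)"
      using chinese_remainder_int[OF coprime_pq pos] by blast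
    have cop: "coprime v (int (p * q))" "coprime w (int (p * q))"
      using coprime_cong_cong_left[OF v(1)] coprime_cong_cong_left[OF v(2)]
        coprime_cong_cong_left[OF w(1)] coprime_cong_cong_left[OF w(2)] u by simp_all
    have split: "(\<Sum>i\<in>I. f i) = (\<Sum>i\<in>?J. f i) + (\<Sum>i\<in>I - ?J. f i)" for f :: "'i \<Rightarrow> real"
      using I by (subst sum.subset_diff[of ?J I]) auto
    have part1: "(\<Sum>i\<in>?J. saw (p * q) (z * m i)) = (\<Sum>i\<in>?J. saw q (u * r i))" if z: "[z = u] (mod int q)" for z
    proof (rule sum.cong[OF refl])
      fix i assume "i \<in> ?J"
      then have "z * m i = int p * (z * r i)" using r[of i] by simp
      then have "saw (p * q) (z * m i) = saw q (z * r i)" by (simp only: saw_p_multiple)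
      also have "\<dots> = saw q (u * r i)" by (rule saw_cong[OF cong_scalar_right[OF z]])
      finally show "saw (p * q) (z * m i) = saw q (u * r i)" .
    qed
    have part2: "(\<Sum>i\<in>I - ?J. saw (p * q) (w * m i)) = - (\<Sum>i\<in>I - ?J. saw (p * q) (v * m i))"
      unfolding sum_negf[symmetric]
    proof (rule sum.cong[OF refl])
      fix i assume i: "i \<in> I - ?J"
      have qi: "int q dvd m i" using i by (intro q_dvd) auto
      have "[- v = - 1] (mod int p)" using v(1) by (simp add: cong_minus_minus_iff)
      then have "[w = - v] (mod int p)" using w(1) by (meson cong_sym cong_trans)
      then have "[w * m i = - v * m i] (mod int p)" by (rule cong_scalar_right)
      moreover have "[w * m i = - v * m i] (mod int q)"
        using qi by (simp add: cong_iff_dvd_diff)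
      ultimately have "[w * m i = - v * m i] (mod int p * int q)"
        by (rule coprime_cong_mult) (use coprime_pq in simp)
      then have "saw (p * q) (w * m i) = saw (p * q) (- (v * m i))"
        by (intro saw_cong) simp
      also have "\<dots> = - saw (p * q) (v * m i)"
      proof (rule saw_minus)
        show "\<not> int (p * q) dvd v * m i"
          using cop(1) not_dvd[of i] i by (simp add: coprime_dvd_mult_right_iff coprime_commute)
      qed (use pos in simp)
      finally show "saw (p * q) (w * m i) = - saw (p * q) (v * m i)" .
    qed
    have "0 = (\<Sum>i\<in>?J. saw q (u * r i)) + (\<Sum>i\<in>I - ?J. saw (p * q) (v * m i))"
      using rel[OF cop(1)] split[of "\<lambda>i. saw (p * q) (v * m i)"] part1[OF v(2)] by simp
    moreover have "0 = (\<Sum>i\<in>?J. saw q (u * r i)) - (\<Sum>i\<in>I - ?J. saw (p * q) (v * m i))"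
      using rel[OF cop(2)] split[of "\<lambda>i. saw (p * q) (w * m i)"] part1[OF w(2)] part2 by simp
    ultimately show ?thesis by simp
  qed
  have r_unit: "coprime (r i) (int q)" if "i \<in> ?J" for i
  proof -
    have "\<not> int q dvd r i"
    proof
      assume "int q dvd r i"
      then have "int (p * q) dvd m i" using that r[of i] by simp
      then show False using not_dvd that by blast
    qed
    then show ?thesis using coprime_int_prime_iff[OF q(1)] by simp
  qed
  \<comment> \<open>At the class of \<open>r i0\<close> the summand of \<open>i0\<close> is
    \<open>q - 1\<close>, and no summand is negative, because \<open>r i\<close> congruent to
    \<open>- r i0\<close> would give a zero pair.\<close>
  have "(\<Sum>i\<in>?J. delta q (r i) (r i0) - delta q (r i) (- r i0)) = 0"
    by (rule sum_delta_prime_eq_0[OF q(1) _ H]) (use q r_unit i0 in auto)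
  moreover have "0 \<le> delta q (r i) (r i0) - delta q (r i) (- r i0)" if "i \<in> ?J" for i
  proof -
    have "\<not> [r i = - r i0] (mod int q)"
    proof
      assume "[r i = - r i0] (mod int q)"
      then have "int q dvd r i + r i0" by (simp add: cong_iff_dvd_diff)
      then have "int (p * q) dvd int p * (r i + r i0)" by simp
      also have "int p * (r i + r i0) = m i + m i0" using r[of i] r[of i0] that i0 by (simp add: distrib_left)
      finally show False using no_pair that i0 by blast
    qed
    then show ?thesis using q by (simp add: delta_def)
  qed
  moreover have "0 < delta q (r i0) (r i0) - delta q (r i0) (- r i0)"
  proof -
    have "\<not> [r i0 = - r i0] (mod int q)"
    proof
      assume "[r i0 = - r i0] (mod int q)"
      then have "int q dvd r i0 + r i0" by (simp add: cong_iff_dvd_diff)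
      then have "int (p * q) dvd int p * (r i0 + r i0)" by simp
      also have "int p * (r i0 + r i0) = m i0 + m i0" using r[of i0] i0 by (simp add: distrib_left)
      finally show False using no_pair i0 by blast
    qed
    then show ?thesis using q by (simp add: delta_def)
  qed
  moreover have "finite ?J" using I by simp
  ultimately show False
    using sum_pos2[of ?J i0 "\<lambda>i. delta q (r i) (r i0) - delta q (r i) (- r i0)"] i0 by simp
qed

lemma contradiction: False
proof -
  interpret s: saw_relation q p I m by (rule swapped)
  obtain i where i: "i \<in> I" using I by fastforce
  have "\<not> int p dvd m i" "\<not> int q dvd m i" using no_multiple_of_p s.no_multiple_of_p i by auto
  then have "i \<in> units"
    using i coprime_int_prime_iff[OF p(1)] coprime_int_prime_iff[OF q(1)] by (simp add: units_def)
  then show False using units_eq_empty by simp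
qed

end

section \<open>Sequences over a cyclic group\<close>

context
  fixes G (structure) and h :: 'a and n :: nat
  assumes comm: "comm_group G" and fin: "finite (carrier G)" and n: "order G = n" "1 < n"
    and h: "h \<in> generators G"
begin

interpretation comm_group G by (rule comm)

lemma h_carrier: "h \<in> carrier G" using h by (simp add: generators_def)

lemma ord_h: "ord h = n"
  using generate_pow_card[OF h_carrier] h n by (simp add: generators_def Coset.order_def)

lemma pow_cong_iff: "h [^] (a::nat) = h [^] (b::nat) \<longleftrightarrow> [a = b] (mod n)"
proof (induction a b rule: linorder_wlog)
  case (le a b)
  have "h [^] a = h [^] b \<longleftrightarrow> h [^] a \<otimes> h [^] (b - a) = h [^] a \<otimes> \<one>"
    using le h_carrier by (simp add: nat_pow_mult) auto
  also have "\<dots> \<longleftrightarrow> h [^] (b - a) = \<one>"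
    using h_carrier by (subst l_cancel) auto
  also have "\<dots> \<longleftrightarrow> n dvd b - a"
    using pow_eq_id[OF h_carrier] ord_h by simp
  also have "\<dots> \<longleftrightarrow> [a = b] (mod n)"
    using cong_altdef_nat[OF le, of n] cong_sym_eq[of a b n] by simp
  finally show ?case .
next
  case (sym a b)
  then show ?case by (metis cong_sym)
qed

lemma gen_coeff_spec:
  assumes "x \<in> carrier G"
  shows "1 \<le> gen_coeff G h x" "gen_coeff G h x \<le> n" "h [^] gen_coeff G h x = x"
  using theI'[OF gen_coeff_unique[OF is_group fin h assms]] n unfolding gen_coeff_def by auto

lemma gen_coeff_eqI:
  assumes "x \<in> carrier G" "1 \<le> k" "k \<le> n" "x = h [^] k"
  shows "gen_coeff G h x = k"
  unfolding gen_coeff_def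
  by (rule the1_equality[OF gen_coeff_unique[OF is_group fin h assms(1)]]) (use assms n in auto)

lemma seq_sum_eq_pow:
  assumes "set_mset T \<subseteq> carrier G"
  shows "seq_sum G T = h [^] (\<Sum>x\<in>#T. gen_coeff G h x)"
  using assms
proof (induction T)
  case empty
  then show ?case by (simp add: seq_sum_empty comm)
next
  case (add x T)
  then show ?case
    using gen_coeff_spec(3)[of x] h_carrier by (simp add: seq_sum_add_mset[OF comm] nat_pow_mult[symmetric])
qed

lemma zero_sum_iff:
  assumes "set_mset T \<subseteq> carrier G"
  shows "zero_sum G T \<longleftrightarrow> n dvd (\<Sum>x\<in>#T. gen_coeff G h x)"
  unfolding zero_sum_def seq_sum_eq_pow[OF assms] using pow_eq_id[OF h_carrier] ord_h by simp

lemma generator_pow: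
  assumes "coprime v n"
  shows "h [^] v \<in> generators G"
proof -
  obtain u where u: "[v * u = 1] (mod n)" using cong_solve_coprime_nat[OF assms] by auto
  have "carrier G = generate G {h}" using h by (simp add: generators_def)
  also have "\<dots> \<subseteq> generate G {h [^] v}"
  proof (rule generate_subgroup_incl)
    show sub: "subgroup (generate G {h [^] v}) G" using h_carrier by (intro generate_is_subgroup) simp
    have "(h [^] v) [^] k \<in> generate G {h [^] v}" for k :: nat
      by (induction k) (auto intro: subgroup.one_closed[OF sub] subgroup.m_closed[OF sub] generate.incl)
    from this[of u] have "(h [^] v) [^] u \<in> generate G {h [^] v}" .
    moreover have "(h [^] v) [^] u = h"
      using pow_cong_iff[of "v * u" 1] u h_carrier by (simp add: nat_pow_pow)
    ultimately show "{h} \<subseteq> generate G {h [^] v}" by simp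
  qed
  finally have "generate G {h [^] v} = carrier G"
    using generate_incl[of "{h [^] v}"] h_carrier by auto
  then show ?thesis using h_carrier by (simp add: generators_def)
qed

end

text \<open>Coefficients with respect to \<open>h [^] v\<close> are multiplied by the inverse of
  \<open>v\<close>. They range from 1 to n, so the reduced product is the coefficient only if it is
  nonzero, which \<open>x \<noteq> \<one>\<close> ensures.\<close>

lemma gen_coeff_pow:
  fixes G (structure)
  assumes comm: "comm_group G" and fin: "finite (carrier G)" and n: "order G = n" "1 < n"
    and h: "h \<in> generators G" and x: "x \<in> carrier G" "x \<noteq> \<one>" and uv: "[u * v = 1] (mod n)"
  shows "gen_coeff G (h [^] v) x = (u * gen_coeff G h x) mod n"
proof -
  interpret comm_group G by (rule comm)
  have hc: "h \<in> carrier G" by (rule h_carrier[OF comm fin n h])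
  have cv: "coprime v n" using uv unfolding coprime_iff_invertible_nat by (auto simp: mult.commute[of v])
  let ?c = "gen_coeff G h x"
  have "h [^] (v * ((u * ?c) mod n)) = h [^] ?c"
  proof (subst pow_cong_iff[OF comm fin n h])
    have "[v * ((u * ?c) mod n) = (u * v) * ?c] (mod n)"
      by (simp add: cong_def mod_mult_right_eq mult_ac)
    also have "[(u * v) * ?c = 1 * ?c] (mod n)" by (rule cong_scalar_right[OF uv])
    finally show "[v * ((u * ?c) mod n) = ?c] (mod n)" by simp
  qed
  then have eq: "x = (h [^] v) [^] ((u * ?c) mod n)"
    using gen_coeff_spec(3)[OF comm fin n h x(1)] hc by (simp add: nat_pow_pow)
  have "(u * ?c) mod n \<noteq> 0"
    using eq x(2) hc by (metis nat_pow_0)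
  then have "1 \<le> (u * ?c) mod n" by simp
  moreover have "(u * ?c) mod n \<le> n" using n by simp
  ultimately show ?thesis
    by (rule gen_coeff_eqI[OF comm fin n generator_pow[OF comm fin n h cv] x(1) _ _ eq])
qed

lemma mset_eq_image_nth: "mset xs = image_mset (nth xs) (mset_set {..<length xs})"
  using mset_map[of "nth xs" "[0..<length xs]"] by (simp only: map_nth mset_upt atLeast0LessThan)

theorem theorem4p4:
  fixes G :: "'a monoid" and p q :: nat and S :: "'a multiset"
  assumes "Factorial_Ring.prime p" and "Factorial_Ring.prime q" and "p \<noteq> q"
    and "gcd (p * q) 6 = 1"
    and "group G" and "cyclic_group G" and "finite (carrier G)" and "order G = p * q"
    and "set_mset S \<subseteq> carrier G"
    and "minimal_zero_sum G S"
    and "size S = 4"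
  shows "seq_index G S = 1"
proof -
  note fin = \<open>finite (carrier G)\<close> and n = \<open>order G = p * q\<close>
  have comm: "comm_group G"
    using assms(5,6) group.cyclic_imp_abelian_group by blast
  have cop6: "coprime (p * q) 6" using assms(4) by (simp only: coprime_iff_gcd_eq_1)
  have five: "5 \<le> r" if "prime r" "r dvd p * q" for r
  proof -
    have "coprime r 6"
      by (rule coprime_divisors[OF that(2) dvd_refl cop6])
    then have "r \<noteq> 2" "r \<noteq> 3"
      using coprime_common_divisor[of r 6 2] coprime_common_divisor[of r 6 3] by auto
    moreover have "r \<noteq> 4" using that(1) prime_product[of 2 2] by auto
    ultimately show ?thesis using prime_ge_2_nat[OF that(1)] by simp
  qed
  have p5: "5 \<le> p" and q5: "5 \<le> q" using five assms(1,2) by auto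
  have n1: "1 < p * q" using p5 q5 less_1_mult[of p q] by simp
  have N0: "0 < int (p * q)" using n1 by (simp only: of_nat_0_less_iff)
  have n_odd: "coprime (p * q) 2"
    by (rule coprime_divisors[OF dvd_refl _ cop6]) simp
  have attained: "finite {seq_norm G h S | h. h \<in> generators G}" "{seq_norm G h S | h. h \<in> generators G} \<noteq> {}"
    using seq_index_attained[OF fin assms(6)] by auto
  obtain xs where xs: "mset xs = S" using ex_mset by blast
  then have len: "length xs = 4" using assms(11) by (metis size_mset)
  have xs_c: "xs ! i \<in> carrier G" if "i < 4" for i
    using that assms(9) xs len by (metis nth_mem set_mset_mset subsetD)
  \<comment> \<open>Indexing by positions separates repeated elements and lets subsets of the four
    positions stand for subsequences.\<close>
  have S_eq: "S = image_mset (nth xs) (mset_set {..<4})"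
    using mset_eq_image_nth[of xs] xs len by simp
  define c where "c = (\<lambda>h i. gen_coeff G h (xs ! i))"
  have zs: "zero_sum G (image_mset (nth xs) (mset_set J)) \<longleftrightarrow> p * q dvd (\<Sum>i\<in>J. c h i)"
    if "J \<subseteq> {..<4}" "h \<in> generators G" for J h
  proof -
    have "finite J" using that(1) finite_subset by blast
    then show ?thesis
      using that xs_c by (subst zero_sum_iff[OF comm fin n n1 that(2)])
        (auto simp: c_def sum_unfold_sum_mset multiset.map_comp comp_def)
  qed
  have full: "p * q dvd (\<Sum>i<4. c h i)" if "h \<in> generators G" for h
    using zs[OF _ that, of "{..<4}"] assms(10) S_eq by (simp add: minimal_zero_sum_def)
  \<comment> \<open>Needed for one and two positions: single terms are nonzero, and no two of them
    cancel.\<close>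
  have proper: "\<not> p * q dvd (\<Sum>i\<in>J. c h i)" if J: "J \<subseteq> {..<4}" "card J < 4" "J \<noteq> {}" and h: "h \<in> generators G" for J h
  proof -
    have fJ: "finite J" using J(1) finite_subset by blast
    let ?T = "image_mset (nth xs) (mset_set J)"
    have "mset_set J \<subseteq># mset_set {..<4}" using J by (intro subset_imp_msubset_mset_set) auto
    then have "?T \<subseteq># S" unfolding S_eq by (rule image_mset_subseteq_mono)
    moreover have "size ?T < size S" using J(2) assms(11) by simp
    ultimately have "?T \<subset># S" unfolding subset_mset.less_le by auto
    moreover have "?T \<noteq> {#}" using J fJ by (simp add: mset_set_empty_iff)
    ultimately have "\<not> zero_sum G ?T" using assms(10) by (simp add: minimal_zero_sum_def)
    then show ?thesis using zs[OF J(1) h] by simp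
  qed
  have norm: "seq_norm G h S = real (\<Sum>i<4. c h i) / real (p * q)" for h
    unfolding seq_norm_def n S_eq by (simp add: c_def sum_unfold_sum_mset multiset.map_comp comp_def)
  have c_pos: "1 \<le> c h i" if "i < 4" "h \<in> generators G" for i h
    unfolding c_def using gen_coeff_spec(1)[OF comm fin n n1 that(2) xs_c[OF that(1)]] .
  have ge1: "1 \<le> seq_norm G h S" if h: "h \<in> generators G" for h
  proof -
    have "0 < (\<Sum>i<4. c h i)" using c_pos[OF _ h] by (intro sum_pos) (auto simp: Suc_le_eq lessThan_empty_iff)
    then have "p * q \<le> (\<Sum>i<4. c h i)" using full[OF h] by (intro dvd_imp_le)
    then have "real (p * q) \<le> real (\<Sum>i<4. c h i)" by (simp only: of_nat_le_iff)
    then show ?thesis unfolding norm using n1 by (subst pos_le_divide_eq) (simp_all only: of_nat_0_less_iff mult_1)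
  qed
  have "\<exists>h\<in>generators G. seq_norm G h S = 1"
  proof (rule ccontr)
    assume none: "\<not> (\<exists>h\<in>generators G. seq_norm G h S = 1)"
    obtain h where h: "h \<in> generators G" using attained(2) by blast
    define m where "m = (\<lambda>i. int (c h i))"
    have not_dvd1: "\<not> p * q dvd c h i" if "i < 4" for i
    proof -
      have "\<not> p * q dvd (\<Sum>j\<in>{i}. c h j)"
        by (rule proper[OF _ _ _ h]) (use that in simp_all)
      then show ?thesis by simp
    qed
    have x1: "xs ! i \<noteq> \<one>\<^bsub>G\<^esub>" if "i < 4" for i
    proof
      assume "xs ! i = \<one>\<^bsub>G\<^esub>"
      then have "c h i = p * q"
        unfolding c_def
        using pow_cong_iff[OF comm fin n n1 h, of "p * q" 0] assms(5) n1 p5 q5 xs_c[OF that]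
        by (intro gen_coeff_eqI[OF comm fin n n1 h]) (auto simp: cong_def)
      then show False using not_dvd1[OF that] by simp
    qed
    \<comment> \<open>The residues of \<open>u * m i\<close> are the coefficients with respect to
      \<open>h [^] v\<close>, where v is inverse to u; if they summed to \<open>p * q\<close>, that
      generator would have norm 1.\<close>
    have ne_n: "(\<Sum>i<4. (u * m i) mod int (p * q)) \<noteq> int (p * q)" if u: "coprime u (int (p * q))" for u
    proof
      assume eq: "(\<Sum>i<4. (u * m i) mod int (p * q)) = int (p * q)"
      define u' where "u' = nat (u mod int (p * q))"
      have u': "int u' = u mod int (p * q)"
        unfolding u'_def by (rule nat_0_le, rule pos_mod_sign[OF N0])
      have "coprime (int u') (int (p * q))" 
        unfolding u' using u N0 coprime_mod_left_iff[of "int (p * q)" u] by (metis less_irrefl)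
      then have "coprime u' (p * q)" by (simp only: coprime_int_iff)
      then obtain v where v: "[u' * v = 1] (mod p * q)"
        unfolding One_nat_def using cong_solve_coprime_nat by blast
      then have cv: "coprime v (p * q)" unfolding coprime_iff_invertible_nat by (auto simp: mult.commute[of v])
      have gv: "h [^]\<^bsub>G\<^esub> v \<in> generators G" by (rule generator_pow[OF comm fin n n1 h cv])
      have "int (c (h [^]\<^bsub>G\<^esub> v) i) = (u * m i) mod int (p * q)" if "i < 4" for i
      proof -
        have "c (h [^]\<^bsub>G\<^esub> v) i = (u' * c h i) mod (p * q)"
          unfolding c_def by (rule gen_coeff_pow[OF comm fin n n1 h xs_c[OF that] x1[OF that] v])
        then have "int (c (h [^]\<^bsub>G\<^esub> v) i) = (int u' * m i) mod int (p * q)"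
          by (simp only: zmod_int of_nat_mult m_def)
        then show ?thesis unfolding u' by (simp only: mod_mult_left_eq)
      qed
      then have "int (\<Sum>i<4. c (h [^]\<^bsub>G\<^esub> v) i) = (\<Sum>i<4. (u * m i) mod int (p * q))"
        unfolding of_nat_sum by (intro sum.cong) simp_all
      also note eq
      finally have "int (\<Sum>i<4. c (h [^]\<^bsub>G\<^esub> v) i) = int (p * q)" .
      then have "(\<Sum>i<4. c (h [^]\<^bsub>G\<^esub> v) i) = p * q" by (simp only: of_nat_eq_iff)
      then have "seq_norm G (h [^]\<^bsub>G\<^esub> v) S = 1" unfolding norm using p5 q5 by simp
      then show False using none gv by blast
    qed
    have cop_dvd: "\<not> int (p * q) dvd u * m i" if "coprime u (int (p * q))" "i < 4" for u i
    proof -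
      have "\<not> int (p * q) dvd m i" unfolding m_def using not_dvd1[OF that(2)] by (simp only: int_dvd_int_iff not_False_eq_True)
      moreover have "coprime (int (p * q)) u" using that(1) by (subst coprime_commute)
      ultimately show ?thesis by (subst coprime_dvd_mult_right_iff)
    qed
    have "saw_relation p q {..<4::nat} m"
    proof
      show "int (p * q) dvd (\<Sum>i<4. m i)"
        using full[OF h] by (simp only: m_def int_dvd_int_iff flip: of_nat_sum)
      show "\<not> int (p * q) dvd m i + m j" if ij: "i \<in> {..<4}" "j \<in> {..<4}" for i j :: nat
      proof (cases "i = j")
        case True
        \<comment> \<open>For equal indices \<open>m i + m i\<close> is \<open>2 * m i\<close>, and
          2 is a unit.\<close>
        have "coprime (int (p * q)) 2" using n_odd by (metis coprime_int_iff of_nat_numeral)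
        then have "\<not> int (p * q) dvd 2 * m i"
          using cop_dvd[of 2 i] ij by (simp add: coprime_commute)
        then show ?thesis using True by simp
      next
        case False
        have "\<not> p * q dvd (\<Sum>k\<in>{i, j}. c h k)"
          by (rule proper[OF _ _ _ h]) (use ij False in simp_all)
        then have "\<not> p * q dvd c h i + c h j" using False by simp
        then show ?thesis by (simp only: m_def int_dvd_int_iff not_False_eq_True flip: of_nat_add)
      qed
      show "(\<Sum>i<4. saw (p * q) (u * m i)) = 0" if u: "coprime u (int (p * q))" for u
      proof -
        let ?s = "\<lambda>u. \<Sum>i<4. (u * m i) mod int (p * q)"
        have "int (p * q) dvd (\<Sum>i<4. u * m i)"
          using full[OF h] unfolding sum_distrib_left[symmetric]
          by (intro dvd_mult) (simp only: m_def int_dvd_int_iff flip: of_nat_sum)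
        then have "int (p * q) dvd ?s u"
          by (simp only: dvd_eq_mod_eq_0 mod_sum_eq)
        then obtain k where k: "?s u = int (p * q) * k" by blast
        \<comment> \<open>The residues lie strictly between 0 and \<open>p * q\<close>, so
          \<open>k\<close> is 1, 2 or 3. The value 1 is excluded by \<open>ne_n\<close>, and 3
          becomes 1 on passing to \<open>- u\<close>.\<close>
        have pos: "0 < (u * m i) mod int (p * q)" "(u * m i) mod int (p * q) < int (p * q)" if "i < 4" for i
          using cop_dvd[OF u that] pos_mod_sign[OF N0, of "u * m i"] pos_mod_bound[OF N0, of "u * m i"]
          unfolding dvd_eq_mod_eq_0 by linarith+
        have "0 < ?s u" using pos by (intro sum_pos) (auto simp: lessThan_empty_iff)
        moreover have "?s u < (\<Sum>i<4::nat. int (p * q))" using pos by (intro sum_strict_mono) (auto simp: lessThan_empty_iff)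
        ultimately have "0 < int (p * q) * k" "int (p * q) * k < int (p * q) * 4" unfolding k by simp_all
        then have "0 < k" "k < 4" using N0 by (simp_all only: zero_less_mult_pos mult_less_cancel_left_pos)
        moreover have "k \<noteq> 1" using ne_n[OF u] k by auto
        moreover have "k \<noteq> 3"
        proof
          assume "k = 3"
          have "?s (- u) = (\<Sum>i<4. int (p * q) - (u * m i) mod int (p * q))"
          proof (rule sum.cong[OF refl])
            fix i :: nat assume "i \<in> {..<4}"
            then show "(- u * m i) mod int (p * q) = int (p * q) - (u * m i) mod int (p * q)"
              using cop_dvd[OF u, of i] by (simp add: zmod_zminus1_eq_if dvd_eq_mod_eq_0)
          qed
          also have "\<dots> = int (p * q) * 4 - ?s u" by (simp add: sum_subtractf)
          also have "\<dots> = int (p * q)" unfolding k \<open>k = 3\<close> by simp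
          finally show False using ne_n[of "- u"] u by simp
        qed
        ultimately have "k = 2" by linarith
        \<comment> \<open>The 2 collects the four shifts by 1/2 and cancels against
          \<open>k = 2\<close>.\<close>
        have "(\<Sum>i<4. saw (p * q) (u * m i)) = of_int (?s u) / of_nat (p * q) - 2"
          by (simp add: saw_def sum_subtractf sum_divide_distrib)
        also have "\<dots> = 0" unfolding k \<open>k = 2\<close> using p5 q5 by simp
        finally show ?thesis .
      qed
    qed (use assms(1-3) p5 q5 in auto)
    then show False by (rule saw_relation.contradiction)
  qed
  then obtain h where "h \<in> generators G" "seq_norm G h S = 1" by blast
  then show ?thesis
    unfolding seq_index_def using attained(1) ge1 by (intro Min_eqI) force+
qed

end
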